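(* Let $q$ be a prime power, $F=\mathbb F_q$, let $d=\sum_{i=1}^rd_i$ with $d_i>0$ integers, put $\mathcal P=(d_1,\dots,d_r)$, and let $n>1$ be an integer with $n\mid(q-1)$. Suppose that $n\ge r$. Then there exists a generalized weighing matrix $$A\in GW\left(\genfrac{[}{]}{0pt}{}{d}{d_1,d_2,\dots,d_r}_q,\;q^{\frac12\left(d^2-\sum_id_i^2\right)};\;n\right),$$ with rows indexed by $X=\mathrm{Flag}(\mathcal P,F)$ and columns indexed by the dual $GL_d(F)$-set $Y$, such that $|A|$ is the characteristic matrix of the $GL_d(F)$-orbit in $X\times Y$ spanned by $(x_0,y_0)$. Moreover, every automorphism in the image of $GL_d(F)\to\mathrm{PermAut}(|A|)$ lifts to an automorphism of $A$.
   Context: $\mu_n\subset\mathbb C^\times$ is the group of $n$-th roots of unity, $\mu_n^+=\{0\}\cup\mu_n$. $GW(N,w;n)$ is the set of $N\times N$ matrices $W$ with entries in $\mu_n^+$ and $WW^*=wI_N$ ($*$ is conjugate-transpose). $|A|$ is the entrywise absolute value. The Gaussian multinomial coefficient is $\genfrac{[}{]}{0pt}{}{d}{d_1,\dots,d_r}_q=\frac{[d]_q!}{\prod_i[d_i]_q!}$ with $[m]_q=\frac{q^m-1}{q-1}$ and $[m]_q!=[1]_q\cdots[m]_q$. $\mathrm{Flag}(\mathcal P,F)$ is the set of flags of type $\mathcal P$: chains of subspaces $V_1\subset V_2\subset\cdots\subset V_r=F^d$ with $\dim V_i=\sum_{j\le i}d_j$. $GL_d(F)$ acts on $X=\mathrm{Flag}(\mathcal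 P,F)$ in the natural way. $Y$ is the same set as $X$, but $g\in GL_d(F)$ acts on $Y$ as $(g^{-1})^T$ acts on $X$. $x_0=y_0$ is the standard flag, in which $V_i$ is spanned by the first $\sum_{j\le i}d_j$ standard basis vectors. $\mathrm{PermAut}(|A|)$ is the group of pairs $(P,Q)$ of permutation matrices (indexed by $X$ and $Y$) with $P|A|Q^*=|A|$; $GL_d(F)$ maps to it by the permutation matrices of its actions on $X$ and $Y$. An automorphism of $A$ is a pair $(P,Q)$ of monomial matrices with nonzero entries in $\mu_n$ such that $PAQ^*=A$; it lifts $(|P|,|Q|)\in\mathrm{PermAut}(|A|)$. *)

theory Defs
  imports "HOL-Analysis.Analysis" "HOL-Number_Theory.Prime_Powers"
begin

subsection \<open>Roots of unity and matrices with arbitrary finite index sets\<close>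

text \<open>
  A matrix with rows indexed by X and columns indexed by Y is a function of two arguments, of
  which only the values on X and Y matter; equality of such matrices is therefore \<open>mat_eq\<close>.
\<close>

definition mu :: "nat \<Rightarrow> complex set" where
  "mu n = {z. z ^ n = 1}"

definition mu_plus :: "nat \<Rightarrow> complex set" where
  "mu_plus n = insert 0 (mu n)"

definition mat_eq :: "'x set \<Rightarrow> 'y set \<Rightarrow> ('x \<Rightarrow> 'y \<Rightarrow> complex) \<Rightarrow> ('x \<Rightarrow> 'y \<Rightarrow> complex) \<Rightarrow> bool" where
  "mat_eq X Y A B \<longleftrightarrow> (\<forall>x\<in>X. \<forall>y\<in>Y. A x y = B x y)"

text \<open>The first argument of \<open>mat_mul\<close> is the common (inner) index set.\<close>

definition mat_mul ::
    "'y set \<Rightarrow> ('x \<Rightarrow> 'y \<Rightarrow> complex) \<Rightarrow> ('y \<Rightarrow> 'z \<Rightarrow> complex) \<Rightarrow> 'x \<Rightarrow> 'z \<Rightarrow> complex" where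
  "mat_mul Y A B = (\<lambda>x z. \<Sum>y\<in>Y. A x y * B y z)"

definition mat_adj :: "('x \<Rightarrow> 'y \<Rightarrow> complex) \<Rightarrow> 'y \<Rightarrow> 'x \<Rightarrow> complex" where
  "mat_adj A = (\<lambda>y x. cnj (A x y))"

definition mat_abs :: "('x \<Rightarrow> 'y \<Rightarrow> complex) \<Rightarrow> 'x \<Rightarrow> 'y \<Rightarrow> complex" where
  "mat_abs A = (\<lambda>x y. complex_of_real (cmod (A x y)))"

definition scalar_mat :: "complex \<Rightarrow> 'x \<Rightarrow> 'x \<Rightarrow> complex" where
  "scalar_mat c = (\<lambda>x x'. if x = x' then c else 0)"

definition char_mat :: "('x \<times> 'y) set \<Rightarrow> 'x \<Rightarrow> 'y \<Rightarrow> complex" where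
  "char_mat S = (\<lambda>x y. if (x, y) \<in> S then 1 else 0)"

definition GW :: "'x set \<Rightarrow> 'y set \<Rightarrow> nat \<Rightarrow> nat \<Rightarrow> nat \<Rightarrow> ('x \<Rightarrow> 'y \<Rightarrow> complex) set" where
  "GW X Y N w n = {W. finite X \<and> finite Y \<and> card X = N \<and> card Y = N \<and>
     (\<forall>x\<in>X. \<forall>y\<in>Y. W x y \<in> mu_plus n) \<and>
     mat_eq X X (mat_mul Y W (mat_adj W)) (scalar_mat (of_nat w))}"


subsection \<open>Automorphisms\<close>

text \<open>
  With this convention the permutation matrix of f sends the basis vector of x to that of f x, so
  that \<open>perm_mat\<close> is multiplicative.
\<close>

definition perm_mat :: "('x \<Rightarrow> 'x) \<Rightarrow> 'x \<Rightarrow> 'x \<Rightarrow> complex" where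
  "perm_mat f = (\<lambda>x x'. if x = f x' then 1 else 0)"

definition is_perm_mat :: "'x set \<Rightarrow> ('x \<Rightarrow> 'x \<Rightarrow> complex) \<Rightarrow> bool" where
  "is_perm_mat X P \<longleftrightarrow> (\<exists>f. bij_betw f X X \<and> mat_eq X X P (perm_mat f))"

definition is_monomial_mat :: "nat \<Rightarrow> 'x set \<Rightarrow> ('x \<Rightarrow> 'x \<Rightarrow> complex) \<Rightarrow> bool" where
  "is_monomial_mat n X P \<longleftrightarrow>
     (\<forall>x\<in>X. \<exists>!x'. x' \<in> X \<and> P x x' \<noteq> 0) \<and>
     (\<forall>x'\<in>X. \<exists>!x. x \<in> X \<and> P x x' \<noteq> 0) \<and>
     (\<forall>x\<in>X. \<forall>x'\<in>X. P x x' \<noteq> 0 \<longrightarrow> P x x' \<in> mu n)"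

definition preserves_mat ::
    "'x set \<Rightarrow> 'y set \<Rightarrow> ('x \<Rightarrow> 'y \<Rightarrow> complex) \<Rightarrow> ('x \<Rightarrow> 'x \<Rightarrow> complex) \<Rightarrow> ('y \<Rightarrow> 'y \<Rightarrow> complex) \<Rightarrow> bool" where
  "preserves_mat X Y A P Q \<longleftrightarrow> mat_eq X Y (mat_mul Y (mat_mul X P A) (mat_adj Q)) A"

definition PermAut ::
    "'x set \<Rightarrow> 'y set \<Rightarrow> ('x \<Rightarrow> 'y \<Rightarrow> complex) \<Rightarrow> (('x \<Rightarrow> 'x \<Rightarrow> complex) \<times> ('y \<Rightarrow> 'y \<Rightarrow> complex)) set" where
  "PermAut X Y B = {(P, Q). is_perm_mat X P \<and> is_perm_mat Y Q \<and> preserves_mat X Y B P Q}"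

definition Aut ::
    "nat \<Rightarrow> 'x set \<Rightarrow> 'y set \<Rightarrow> ('x \<Rightarrow> 'y \<Rightarrow> complex) \<Rightarrow> (('x \<Rightarrow> 'x \<Rightarrow> complex) \<times> ('y \<Rightarrow> 'y \<Rightarrow> complex)) set" where
  "Aut n X Y A = {(P, Q). is_monomial_mat n X P \<and> is_monomial_mat n Y Q \<and> preserves_mat X Y A P Q}"

definition lifts ::
    "'x set \<Rightarrow> 'y set \<Rightarrow> (('x \<Rightarrow> 'x \<Rightarrow> complex) \<times> ('y \<Rightarrow> 'y \<Rightarrow> complex)) \<Rightarrow>
     (('x \<Rightarrow> 'x \<Rightarrow> complex) \<times> ('y \<Rightarrow> 'y \<Rightarrow> complex)) \<Rightarrow> bool" where
  "lifts X Y \<alpha> \<beta> \<longleftrightarrow>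
     mat_eq X X (mat_abs (fst \<alpha>)) (fst \<beta>) \<and> mat_eq Y Y (mat_abs (snd \<alpha>)) (snd \<beta>)"


subsection \<open>Gaussian multinomial coefficients\<close>

definition qint :: "real \<Rightarrow> nat \<Rightarrow> real" where
  "qint q m = (q ^ m - 1) / (q - 1)"

definition qfact :: "real \<Rightarrow> nat \<Rightarrow> real" where
  "qfact q m = (\<Prod>k=1..m. qint q k)"

definition gauss_multinomial :: "real \<Rightarrow> nat \<Rightarrow> nat list \<Rightarrow> real" where
  "gauss_multinomial q d ds = qfact q d / (\<Prod>k\<leftarrow>ds. qfact q k)"

text \<open>
  The natural number subtraction and division in the exponent of the weight,
  (d^2 - (\<Sum> d_i^2)) div 2 for d = \<Sum> d_i, are exact.
\<close>

lemma sum_list_squares_le: "(\<Sum>k\<leftarrow>ds. k ^ 2) \<le> (sum_list ds :: nat) ^ 2"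
  by (induction ds) (auto simp: power2_sum)

lemma even_weight_exponent: "even ((sum_list ds :: nat) ^ 2 - (\<Sum>k\<leftarrow>ds. k ^ 2))"
proof -
  have "even (sum_list ds :: nat) \<longleftrightarrow> even (\<Sum>k\<leftarrow>ds. k ^ 2)"
    by (induction ds) auto
  then show ?thesis
    using sum_list_squares_le[of ds] by auto
qed


subsection \<open>Flags\<close>

text \<open>
  The space F^d is the type \<open>'f ^ 'd\<close> with \<open>CARD('d) = d\<close>. The linear order on the index type only
  serves to say which are the first k standard basis vectors. A flag of type ds is the list of
  its members.
\<close>

definition psum :: "nat list \<Rightarrow> nat \<Rightarrow> nat" where
  "psum ds i = sum_list (take (Suc i) ds)"

definition Flag :: "nat list \<Rightarrow> (('f::field) ^ 'd::finite) set list set" where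
  "Flag ds = {Vs. length Vs = length ds \<and>
     (\<forall>i<length ds. vec.subspace (Vs ! i) \<and> vec.dim (Vs ! i) = psum ds i) \<and>
     (\<forall>i. Suc i < length ds \<longrightarrow> Vs ! i \<subset> Vs ! Suc i) \<and>
     last Vs = UNIV}"

definition std_flag :: "nat list \<Rightarrow> (('f::field) ^ 'd::{finite,linorder}) set list" where
  "std_flag ds = map (\<lambda>i. vec.span {axis j 1 | j. card {k. k < j} < psum ds i}) [0..<length ds]"

definition GL :: "(('f::field) ^ 'd ^ 'd::finite) set" where
  "GL = {g. invertible g}"

definition actX :: "('f::field) ^ 'd ^ 'd::finite \<Rightarrow> ('f ^ 'd) set list \<Rightarrow> ('f ^ 'd) set list" where
  "actX g Vs = map (\<lambda>V. (\<lambda>v. g *v v) ` V) Vs"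

definition actY :: "('f::field) ^ 'd ^ 'd::finite \<Rightarrow> ('f ^ 'd) set list \<Rightarrow> ('f ^ 'd) set list" where
  "actY g = actX (transpose (matrix_inv g))"

definition std_orbit ::
    "nat list \<Rightarrow>
     ((('f::field) ^ 'd::{finite,linorder}) set list \<times> ('f ^ 'd::{finite,linorder}) set list) set" where
  "std_orbit ds = {(actX g (std_flag ds), actY g (std_flag ds)) | g. g \<in> GL}"

definition gl_perm ::
    "('f::field) ^ 'd ^ 'd::finite \<Rightarrow>
     (('f ^ 'd) set list \<Rightarrow> ('f ^ 'd) set list \<Rightarrow> complex) \<times>
     (('f ^ 'd) set list \<Rightarrow> ('f ^ 'd) set list \<Rightarrow> complex)" where
  "gl_perm g = (perm_mat (actX g), perm_mat (actY g))"

end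

theory Submission
  imports Defs "HOL-Algebra.Multiplicative_Group"
begin

text \<open>
  Choose for every flag \<open>V\<close> a frame, that is, an invertible matrix whose first columns span the
  members of \<open>V\<close>. For frames \<open>M\<close> of \<open>V\<close> and \<open>N\<close> of \<open>W\<close>, the pair \<open>(V, W)\<close> lies in the orbit of the
  standard pair exactly when all leading minors of \<open>M\<^sup>T N\<close> of sizes \<open>d_1\<close>, \<open>d_1 + d_2\<close>, ..., \<open>d\<close> are
  nonzero. Let \<open>D\<close> be the product of these minors and let \<open>\<psi>\<close> be a character of order \<open>n\<close> of the cyclic
  group of nonzero elements of \<open>F\<close>, extended by \<open>\<psi> 0 = 0\<close>. The weighing matrix is
  \<open>A(V, W) = \<psi> (D (M\<^sup>T N))\<close>; its entries vanish exactly outside the orbit.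

  The function \<open>D\<close> turns multiplication by a block upper triangular matrix on the right, or by its
  transpose on the left, into multiplication by a scalar. Any two frames of a flag differ by a block
  upper triangular matrix, so for invertible \<open>g\<close> the entry \<open>A(g V, g^{-T} W)\<close> equals \<open>A(V, W)\<close> up to a
  root of unity that depends on \<open>(g, V)\<close> and one that depends on \<open>(g, W)\<close>
  (\<open>weighing_equivariant\<close>). These two phases are the entries of the monomial matrices that
  lift \<open>g\<close>.

  They also give orthogonality of the rows of \<open>V \<noteq> V'\<close>. If \<open>g\<close> fixes both flags, then replacing \<open>W\<close> by
  \<open>g^{-T} W\<close> multiplies the inner product of the rows by the quotient of the phases of \<open>V\<close> and \<open>V'\<close>, so
  it is enough to find a \<open>g\<close> with distinct phases. Take for \<open>g\<close> a dilation that multiplies a vector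
  \<open>v\<close> by \<open>t\<close> and fixes a complementary hyperplane, where \<open>\<psi> t\<close> has order \<open>n\<close>. It fixes \<open>V\<close> if every
  member of \<open>V\<close> contains \<open>v\<close> or lies in the hyperplane, and then its phase is \<open>(\<psi> t)^{-m}\<close> for the number
  \<open>m\<close> of members containing \<open>v\<close>. There is a choice that fixes \<open>V\<close> and \<open>V'\<close> and has different numbers
  \<open>m\<close> for them (\<open>separating_dilation\<close>). Both numbers lie between 1 and \<open>r\<close>, so the phases
  are distinct because \<open>r \<le> n\<close>.

  Two counts remain. The number of flags is \<open>|GL|\<close> divided by the number of frames of one flag
  (\<open>card_frames\<close>), and \<open>|GL|\<close> is the number of frames of the trivial flag of type \<open>[d]\<close>.
  The weight is the number of \<open>W\<close> opposite to a given \<open>V\<close>: by a block form of the LU decomposition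
  these correspond to the block lower unipotent matrices (\<open>opposite_flags\<close>), which have
  \<open>(d\<^sup>2 - \<Sum> d_i\<^sup>2) / 2\<close> free entries.
\<close>

section \<open>Characters of a finite field\<close>

text \<open>
  Finite subgroups of the units of a field are cyclic. That theorem is stated for fields given as
  records, so the type is viewed as such a record.
\<close>

lemma finite_field_primitive_element:
  obtains g :: "'f::{field,finite}" where "g \<noteq> 0" "\<And>x::'f. x \<noteq> 0 \<Longrightarrow> \<exists>i. x = g ^ i"
proof -
  define R :: "'f ring" where "R = \<lparr>carrier = UNIV, mult = (*), one = 1, zero = 0, add = (+)\<rparr>"
  have neg: "\<exists>y. x + y = 0" and inv: "x \<noteq> 0 \<Longrightarrow> \<exists>y. x * y = 1" for x :: 'f
    using right_minus right_inverse by blast+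
  have "Ring.field R"
    by unfold_locales (auto simp: R_def Units_def algebra_simps neg inv)
  then interpret Ring.field R .
  have pow: "x [^]\<^bsub>R\<^esub> (i::nat) = x ^ i" for x i
    by (induction i) (auto simp: R_def nat_pow_def mult.commute)
  obtain a where "a \<in> carrier (mult_of R)" "carrier (mult_of R) = {a[^]\<^bsub>R\<^esub>i | i::nat . i \<in> UNIV}"
    using finite_field_mult_group_has_gen by (auto simp: R_def)
  moreover have "carrier (mult_of R) = {x. x \<noteq> 0}" by (auto simp: R_def)
  ultimately show ?thesis by (intro that[of a]) (auto simp: pow)
qed

text \<open>
  The character sends the \<open>i\<close>-th power of a primitive element to the \<open>i\<close>-th power of a primitive
  \<open>n\<close>-th root of unity, which is well defined because \<open>n\<close> divides the order of the primitive element.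
  The element \<open>t\<close> is the primitive element, and the last conclusion says that its image has order
  exactly \<open>n\<close>.
\<close>

lemma finite_field_character:
  assumes n: "n > 0" "n dvd CARD('f) - 1"
  obtains \<psi> :: "'f::{field,finite} \<Rightarrow> complex" and t :: 'f where
    "\<And>x y. \<psi> (x * y) = \<psi> x * \<psi> y" "\<psi> 0 = 0" "\<psi> 1 = 1" "\<And>x. x \<noteq> 0 \<Longrightarrow> \<psi> x ^ n = 1"
    "t \<noteq> 0" "\<And>k. 0 < k \<Longrightarrow> k < n \<Longrightarrow> \<psi> t ^ k \<noteq> 1"
proof -
  obtain g :: 'f where g: "g \<noteq> 0" "\<And>x. x \<noteq> 0 \<Longrightarrow> \<exists>i. x = g ^ i"
    using finite_field_primitive_element by metis
  have "\<not> inj (\<lambda>i::nat. g ^ i)"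
    using finite_imageD[of "\<lambda>i::nat. g ^ i" UNIV] by auto
  then obtain i j :: nat where ij: "i < j" "g ^ i = g ^ j"
    unfolding inj_def by (metis linorder_neqE_nat)
  have "g ^ (j - i) = 1"
    using ij g(1) by (metis less_imp_le power_diff power_not_zero divide_self)
  then have ex: "\<exists>m>0. g ^ m = 1" using ij(1) by (intro exI[of _ "j - i"]) auto
  \<comment> \<open>the order of \<open>g\<close>; that it is the number of nonzero elements follows from counting the powers of \<open>g\<close>\<close>
  define m where "m = (LEAST m. m > 0 \<and> g ^ m = 1)"
  have m: "m > 0" "g ^ m = 1" using LeastI_ex[OF ex] by (auto simp: m_def)
  have least: "g ^ k \<noteq> 1" if "0 < k" "k < m" for k
    using not_less_Least that unfolding m_def by blast
  have red: "g ^ k = g ^ (k mod m)" for k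
  proof -
    have "g ^ k = g ^ (m * (k div m) + k mod m)" by simp
    also have "\<dots> = g ^ (k mod m)" unfolding power_add power_mult m by simp
    finally show ?thesis .
  qed
  have dvd: "m dvd k" if "g ^ k = 1" for k
    using red[of k] least[of "k mod m"] that m(1) by (metis mod_less_divisor mod_greater_zero_iff_not_dvd)
  have diff: "m dvd l - k" if "g ^ k = g ^ l" "k \<le> l" for k l
    using that g(1) by (intro dvd) (metis power_diff power_not_zero divide_self)
  have "bij_betw (\<lambda>i. g ^ i) {..<m} (UNIV - {0})"
    unfolding bij_betw_def
  proof
    show "inj_on (\<lambda>i. g ^ i) {..<m}"
    proof (rule linorder_inj_onI')
      fix k l assume kl: "k \<in> {..<m}" "l \<in> {..<m}" "k < l"
      show "g ^ k \<noteq> g ^ l"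
        using diff[of k l] kl by (auto dest!: dvd_imp_le)
    qed
    show "(\<lambda>i. g ^ i) ` {..<m} = UNIV - {0}"
    proof
      show "UNIV - {0} \<subseteq> (\<lambda>i. g ^ i) ` {..<m}"
        using g(2) red m(1) by (metis DiffE image_eqI lessThan_iff mod_less_divisor singletonI subsetI)
    qed (use g in auto)
  qed
  then have "m = CARD('f) - 1"
    using bij_betw_same_card[of "\<lambda>i. g ^ i" "{..<m}" "UNIV - {0}"] by simp
  then have nm: "n dvd m" using n by simp
  define \<zeta> where "\<zeta> = cis (2 * pi / real n)"
  have \<zeta>n: "\<zeta> ^ n = 1" using n(1) unfolding \<zeta>_def Complex.DeMoivre by simp
  have \<zeta>k: "\<zeta> ^ k \<noteq> 1" if "0 < k" "k < n" for k
  proof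
    assume "\<zeta> ^ k = 1"
    then have "cos (real k * (2 * pi / real n)) = 1"
      unfolding \<zeta>_def Complex.DeMoivre by (simp add: complex_eq_iff)
    then obtain i :: int where "real k * (2 * pi / real n) = of_int i * 2 * pi"
      unfolding cos_one_2pi_int by auto
    then have "(real k / real n) * (2 * pi) = of_int i * (2 * pi)" by simp
    then have "real k / real n = of_int i"
      by (metis mult_right_cancel pi_neq_zero mult_eq_0_iff zero_neq_numeral)
    moreover have "0 < real k / real n" "real k / real n < 1" using that by auto
    ultimately show False by simp
  qed
  have \<zeta>eq: "\<zeta> ^ k = \<zeta> ^ l" if "g ^ k = g ^ l" for k l
  proof -
    have *: "\<zeta> ^ k = \<zeta> ^ l" if kl: "g ^ k = g ^ l" "k \<le> l" for k l
    proof -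
      have "n dvd l - k" using diff[OF kl] nm by (rule dvd_trans[rotated])
      then obtain c where "l = k + n * c" using kl(2) by (metis dvdE le_add_diff_inverse)
      then show ?thesis by (simp add: power_add power_mult \<zeta>n)
    qed
    show ?thesis using that * by (metis nat_le_linear)
  qed
  define \<psi> where "\<psi> x = (if x = 0 then 0 else \<zeta> ^ (SOME i. x = g ^ i))" for x
  have \<psi>g: "\<psi> (g ^ i) = \<zeta> ^ i" for i
  proof -
    have "g ^ i = g ^ (SOME j. g ^ i = g ^ j)" by (rule someI[of _ i]) simp
    from \<zeta>eq[OF this] show ?thesis using g(1) by (simp add: \<psi>_def)
  qed
  show thesis
  proof (rule that[of \<psi> g])
    fix x y :: 'f
    show "\<psi> (x * y) = \<psi> x * \<psi> y"
    proof (cases "x = 0 \<or> y = 0")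
      case False
      then obtain i j where "x = g ^ i" "y = g ^ j" using g(2) by meson
      then show ?thesis using \<psi>g by (metis power_add)
    qed (auto simp: \<psi>_def)
  next
    fix x :: 'f assume "x \<noteq> 0"
    then obtain i where "x = g ^ i" using g(2) by meson
    then show "\<psi> x ^ n = 1" using \<psi>g \<zeta>n by (metis power_mult mult.commute power_one)
  next
    fix k assume "0 < k" "k < n"
    then show "\<psi> g ^ k \<noteq> 1" using \<zeta>k \<psi>g[of 1] by (metis power_one_right)
  next
    show "\<psi> 1 = 1" using \<psi>g[of 0] by (simp only: power_0)
  qed (simp_all add: g(1) \<psi>_def)
qed


section \<open>Counting independent families in a chain of subspaces\<close>

lemma card_functions_prescribed_outside:
  fixes c :: "'i::finite \<Rightarrow> 'f::finite"
  shows "card {f. \<forall>i. i \<notin> T \<longrightarrow> f i = c i} = CARD('f) ^ card T"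
proof -
  have "bij_betw (\<lambda>f. restrict f T) {f. \<forall>i. i \<notin> T \<longrightarrow> f i = c i} (T \<rightarrow>\<^sub>E UNIV)"
    by (rule bij_betwI[where g = "\<lambda>f i. if i \<in> T then f i else c i"])
       (auto simp: fun_eq_iff extensional_def restrict_def)
  then show ?thesis by (simp add: bij_betw_same_card card_PiE)
qed

lemma card_subspace:
  fixes V :: "('f::{field,finite} ^ 'd::finite) set"
  assumes "vec.subspace V"
  shows "card V = CARD('f) ^ vec.dim V"
proof -
  obtain B where B: "B \<subseteq> V" "vec.independent B" "V \<subseteq> vec.span B" "card B = vec.dim V"
    using vec.basis_exists by blast
  have fin: "finite B" by simp
  have "vec.span B = V" using B assms by (metis vec.span_minimal subset_antisym)
  let ?h = "\<lambda>u. \<Sum>v\<in>B. u v *s v"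
  have "bij_betw ?h (B \<rightarrow>\<^sub>E (UNIV :: 'f set)) V"
    unfolding bij_betw_def
  proof
    show "inj_on ?h (B \<rightarrow>\<^sub>E (UNIV :: 'f set))"
    proof (rule inj_onI)
      fix u w :: "'f ^ 'd \<Rightarrow> 'f"
      assume uw: "u \<in> B \<rightarrow>\<^sub>E UNIV" "w \<in> B \<rightarrow>\<^sub>E UNIV" "?h u = ?h w"
      have "(\<Sum>v\<in>B. (u v - w v) *s v) = 0"
        using uw(3) by (simp add: vec.scale_left_diff_distrib sum_subtractf)
      then have "u v - w v = 0" if "v \<in> B" for v
        using vec.independentD[OF B(2) fin subset_refl, of "\<lambda>v. u v - w v"] that by blast
      then show "u = w" using uw by (intro PiE_ext[OF uw(1,2)]) auto
    qed
    show "?h ` (B \<rightarrow>\<^sub>E UNIV) = V"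
    proof -
      have "?h u \<in> ?h ` (B \<rightarrow>\<^sub>E UNIV)" for u
        by (rule image_eqI[of _ _ "restrict u B"]) simp_all
      then have "?h ` (B \<rightarrow>\<^sub>E UNIV) = range ?h" by blast
      then show ?thesis using \<open>vec.span B = V\<close> vec.span_finite[OF fin] by simp
    qed
  qed
  then show ?thesis using B(4) by (simp add: bij_betw_same_card[symmetric] card_PiE)
qed

lemma dim_subspace_if_card:
  fixes V :: "('f::{field,finite} ^ 'd::finite) set"
  assumes "vec.subspace V" "card V = CARD('f) ^ k"
  shows "vec.dim V = k"
proof -
  have "CARD('f) > 1" using card_mono[of UNIV "{0, 1 :: 'f}"] by simp
  then show ?thesis using card_subspace[OF assms(1)] assms(2) by simp
qed

definition indep_lists :: "(nat \<Rightarrow> ('f::field ^ 'd::finite) set) \<Rightarrow> nat \<Rightarrow> ('f ^ 'd) list set" where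
  "indep_lists W m = {l. length l = m \<and> distinct l \<and> vec.independent (set l) \<and> (\<forall>k<m. l ! k \<in> W k)}"

text \<open>
  Such a list is built one vector at a time: the next vector is any element of \<open>W k\<close> outside the
  span of the \<open>k\<close> vectors chosen so far, and by monotonicity that span lies inside \<open>W k\<close>.
\<close>

lemma card_indep_lists:
  fixes W :: "nat \<Rightarrow> ('f::{field,finite} ^ 'd::finite) set"
  assumes W: "\<And>k. k < m \<Longrightarrow> vec.subspace (W k)"
    and mono: "\<And>k l. k \<le> l \<Longrightarrow> l < m \<Longrightarrow> W k \<subseteq> W l"
  shows "card (indep_lists W m) = (\<Prod>k<m. CARD('f) ^ vec.dim (W k) - CARD('f) ^ k)"
    and "finite (indep_lists W m)"
proof -
  have "card (indep_lists W m) = (\<Prod>k<m. CARD('f) ^ vec.dim (W k) - CARD('f) ^ k) \<and> finite (indep_lists W m)"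
    using assms
  proof (induction m)
    case 0
    have "indep_lists W 0 = {[]}" by (auto simp: indep_lists_def vec.independent_empty)
    then show ?case by simp
  next
    case (Suc m)
    let ?S = "SIGMA l : indep_lists W m. W m - vec.span (set l)"
    have IH: "card (indep_lists W m) = (\<Prod>k<m. CARD('f) ^ vec.dim (W k) - CARD('f) ^ k)" "finite (indep_lists W m)"
      using Suc by auto
    have eq: "indep_lists W (Suc m) = (\<lambda>(l, v). l @ [v]) ` ?S"
    proof safe
      fix l assume l: "l \<in> indep_lists W (Suc m)"
      then obtain l' v where lv: "l = l' @ [v]" "length l' = m"
        unfolding indep_lists_def by (metis (mono_tags, lifting) length_Suc_conv_rev mem_Collect_eq)
      have dist: "distinct (l' @ [v])" and ind: "vec.independent (insert v (set l'))"
        and W': "(l' @ [v]) ! k \<in> W k" if "k < Suc m" for k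
        using l that by (auto simp: indep_lists_def lv(1))
      have "l' ! k \<in> W k" if "k < m" for k
        using W'[of k] that lv(2) by (simp add: nth_append)
      then have "l' \<in> indep_lists W m" "v \<notin> vec.span (set l')"
        using dist[of 0] ind[of 0] lv(2) by (auto simp: indep_lists_def vec.independent_insert)
      moreover have "v \<in> W m" using W'[of m] lv(2) by (simp add: nth_append)
      ultimately have "(l', v) \<in> ?S" by blast
      then show "l \<in> (\<lambda>(l, v). l @ [v]) ` ?S" using lv by force
    next
      fix l v assume "l \<in> indep_lists W m" "v \<in> W m" "v \<notin> vec.span (set l)"
      moreover from this have "v \<notin> set l" using vec.span_base by blast
      ultimately show "l @ [v] \<in> indep_lists W (Suc m)"
        by (auto simp: indep_lists_def vec.independent_insert nth_append less_Suc_eq)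
    qed
    have c: "card (W m - vec.span (set l)) = CARD('f) ^ vec.dim (W m) - CARD('f) ^ m"
      if l: "l \<in> indep_lists W m" for l
    proof -
      have "set l \<subseteq> W m"
      proof
        fix v assume "v \<in> set l"
        then obtain k where "k < m" "v \<in> W k"
          using l by (auto simp: indep_lists_def in_set_conv_nth)
        then show "v \<in> W m" using Suc.prems(2)[of k m] by auto
      qed
      then have "vec.span (set l) \<subseteq> W m" using Suc.prems(1) by (intro vec.span_minimal) auto
      moreover have "vec.dim (vec.span (set l)) = m"
        using that by (simp add: indep_lists_def vec.dim_eq_card_independent distinct_card)
      ultimately show ?thesis
        using Suc.prems(1)[of m] card_subspace[of "vec.span (set l)"]
        by (simp add: card_Diff_subset card_subspace)
    qed
    have "card (indep_lists W (Suc m)) = card ?S"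
      unfolding eq by (rule card_image) (auto simp: inj_on_def)
    also have "\<dots> = (\<Sum>l\<in>indep_lists W m. card (W m - vec.span (set l)))"
      using IH by (subst card_SigmaI) auto
    also have "\<dots> = card (indep_lists W m) * (CARD('f) ^ vec.dim (W m) - CARD('f) ^ m)"
      using c by simp
    finally show ?case using IH eq by simp
  qed
  then show "card (indep_lists W m) = (\<Prod>k<m. CARD('f) ^ vec.dim (W k) - CARD('f) ^ k)"
    "finite (indep_lists W m)" by auto
qed

section \<open>Blocks of a composition\<close>

lemma psum_mono: "i \<le> j \<Longrightarrow> psum ds i \<le> psum ds j"
proof -
  assume "i \<le> j"
  then have "take (Suc j) ds = take (Suc i) ds @ take (j - i) (drop (Suc i) ds)"
    by (metis add_Suc le_add_diff_inverse take_add)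
  then show ?thesis by (simp add: psum_def)
qed

lemma psum_Suc: "Suc i < length ds \<Longrightarrow> psum ds (Suc i) = psum ds i + ds ! Suc i"
  by (simp add: psum_def take_Suc_conv_app_nth)

lemma psum_last: "length ds \<le> Suc i \<Longrightarrow> psum ds i = sum_list ds"
  by (simp add: psum_def)

lemma psum_append: "i < length ds \<Longrightarrow> psum (ds @ es) i = psum ds i"
  by (simp add: psum_def)

lemma psum_le: "psum ds i \<le> sum_list ds"
  using psum_mono[of i "max i (length ds)" ds] psum_last[of ds "max i (length ds)"] by simp

definition block :: "nat list \<Rightarrow> nat \<Rightarrow> nat" where
  "block ds k = (LEAST i. k < psum ds i)"

lemma block_le_iff:
  assumes "k < sum_list ds"
  shows "block ds k \<le> i \<longleftrightarrow> k < psum ds i"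
proof
  have "k < psum ds (length ds)" using assms by (simp add: psum_last)
  then have "k < psum ds (block ds k)" unfolding block_def by (rule LeastI)
  then show "block ds k \<le> i \<Longrightarrow> k < psum ds i" using psum_mono[of "block ds k" i ds] by simp
qed (simp add: block_def Least_le)

lemma block_less_length:
  assumes "k < sum_list ds"
  shows "block ds k < length ds"
proof -
  have "ds \<noteq> []" using assms by auto
  then show ?thesis using block_le_iff[OF assms, of "length ds - 1"] assms
    by (cases ds) (auto simp: psum_last)
qed

lemma block_append:
  assumes "k < sum_list ds"
  shows "block (ds @ es) k = block ds k"
proof -
  have "block (ds @ es) k \<le> i \<longleftrightarrow> block ds k \<le> i" if "i < length ds" for i
    using assms that by (simp add: block_le_iff psum_append)
  then show ?thesis using block_less_length[OF assms]
    by (metis le_antisym le_refl order.strict_trans1)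
qed

lemma block_snoc_last:
  assumes "sum_list ds \<le> k" "k < sum_list ds + m"
  shows "block (ds @ [m]) k = length ds"
proof -
  have "block (ds @ [m]) k < Suc (length ds)"
    using block_less_length[of k "ds @ [m]"] assms by simp
  moreover have "\<not> block (ds @ [m]) k \<le> i" if "i < length ds" for i
    using assms that psum_le[of ds i] by (subst block_le_iff) (auto simp: psum_append)
  ultimately show ?thesis by (metis le_refl less_Suc_eq)
qed

section \<open>The number of frames\<close>

lemma prod_lessThan_add:
  fixes f :: "nat \<Rightarrow> 'a::comm_monoid_mult"
  shows "(\<Prod>k<s+m. f k) = (\<Prod>k<s. f k) * (\<Prod>k=s..<s+m. f k)"
  by (simp add: prod.atLeastLessThan_concat lessThan_atLeast0)

text \<open>
  The number of bases \<open>v_0, v_1, ...\<close> such that each \<open>v_k\<close> lies in the member of a fixed flag of type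
  \<open>ds\<close> that belongs to the block of \<open>k\<close>; this member has dimension \<open>psum ds (block ds k)\<close>.
\<close>

definition num_frames :: "nat \<Rightarrow> nat list \<Rightarrow> nat" where
  "num_frames q ds = (\<Prod>k<sum_list ds. q ^ psum ds (block ds k) - q ^ k)"

text \<open>
  The first two factors depend on \<open>ds\<close> only through its sum, so they cancel when the frame
  counts of two types with the same sum are compared; what is left are the q-factorials.
\<close>

lemma num_frames_eq:
  assumes "q > 1"
  shows "real (num_frames q ds) =
    (\<Prod>k<sum_list ds. real q ^ k) * (real q - 1) ^ sum_list ds * (\<Prod>k\<leftarrow>ds. qfact (real q) k)"
proof (induction ds rule: rev_induct)
  case Nil
  then show ?case by (simp add: num_frames_def)
next
  case (snoc m ds)
  let ?s = "sum_list ds"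
  have old: "(\<Prod>k<?s. q ^ psum (ds @ [m]) (block (ds @ [m]) k) - q ^ k) = num_frames q ds"
    unfolding num_frames_def
    by (rule prod.cong) (auto simp: block_append psum_append block_less_length)
  have new: "(\<Prod>k=?s..<?s+m. q ^ psum (ds @ [m]) (block (ds @ [m]) k) - q ^ k) =
        (\<Prod>k=?s..<?s+m. q ^ (?s + m) - q ^ k)"
    by (rule prod.cong) (auto simp: block_snoc_last psum_last)
  have qf: "qfact (real q) m = (\<Prod>t<m. qint (real q) (m - t))"
    unfolding qfact_def
    by (rule prod.reindex_bij_witness[of _ "\<lambda>t. m - t" "\<lambda>k. m - k"]) auto
  have "real (\<Prod>k=?s..<?s+m. q ^ (?s + m) - q ^ k) =
        (\<Prod>k=?s..<?s+m. real q ^ (?s + m) - real q ^ k)"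
    unfolding of_nat_prod using assms
    by (intro prod.cong refl) (auto simp: of_nat_diff power_increasing)
  also have "\<dots> = (\<Prod>t<m. real q ^ (?s + m) - real q ^ (?s + t))"
    by (rule prod.reindex_bij_witness[of _ "\<lambda>t. ?s + t" "\<lambda>k. k - ?s"]) auto
  also have "\<dots> = (\<Prod>t<m. real q ^ (?s + t) * ((real q - 1) * qint (real q) (m - t)))"
  proof (rule prod.cong)
    fix t assume "t \<in> {..<m}"
    then have "real q ^ (?s + m) = real q ^ (?s + t) * real q ^ (m - t)"
      by (simp flip: power_add)
    then show "real q ^ (?s + m) - real q ^ (?s + t) = real q ^ (?s + t) * ((real q - 1) * qint (real q) (m - t))"
      using assms by (simp add: qint_def field_simps)
  qed simp
  also have "\<dots> = (\<Prod>t<m. real q ^ (?s + t)) * (real q - 1) ^ m * qfact (real q) m"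
    by (simp add: prod.distrib qf)
  finally have last: "real (\<Prod>k=?s..<?s+m. q ^ (?s + m) - q ^ k) = \<dots>" .
  have shift: "(\<Prod>k=?s..<?s+m. real q ^ k) = (\<Prod>t<m. real q ^ (?s + t))"
    by (rule prod.reindex_bij_witness[of _ "\<lambda>t. ?s + t" "\<lambda>k. k - ?s"]) auto
  have "num_frames q (ds @ [m]) = num_frames q ds * (\<Prod>k=?s..<?s+m. q ^ (?s + m) - q ^ k)"
    unfolding num_frames_def[of q "ds @ [m]"] using old new by (simp add: prod_lessThan_add)
  then have "real (num_frames q (ds @ [m])) =
      real (num_frames q ds) * real (\<Prod>k=?s..<?s+m. q ^ (?s + m) - q ^ k)"
    by (simp only: of_nat_mult)
  then show ?case
    unfolding last snoc.IH by (simp add: prod_lessThan_add shift power_add mult_ac)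
qed

lemma num_frames_pos:
  assumes "q > 1"
  shows "num_frames q ds > 0"
proof -
  have "qint (real q) k > 0" if "k \<ge> 1" for k
    using assms that by (simp add: qint_def)
  then have "qfact (real q) k > 0" for k
    unfolding qfact_def by (intro prod_pos) auto
  then have "(\<Prod>k\<leftarrow>ds. qfact (real q) k) > 0" by (induction ds) auto
  then have "real (num_frames q ds) > 0"
    unfolding num_frames_eq[OF assms] using assms by (intro mult_pos_pos prod_pos) auto
  then show ?thesis by simp
qed

definition rank_of :: "'d::{finite,linorder} \<Rightarrow> nat" where
  "rank_of j = card {k. k < j}"

lemma bij_rank_of: "bij_betw rank_of (UNIV :: 'd::{finite,linorder} set) {..<CARD('d)}"
proof -
  have mono: "rank_of i < rank_of j" if "i < j" for i j :: 'd
    unfolding rank_of_def using that by (intro psubset_card_mono) auto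
  have inj: "inj (rank_of :: 'd \<Rightarrow> nat)"
    by (metis injI linorder_neqE mono less_irrefl)
  have "rank_of j < CARD('d)" for j :: 'd
    unfolding rank_of_def by (intro psubset_card_mono) auto
  then have "range (rank_of :: 'd \<Rightarrow> nat) = {..<CARD('d)}"
    by (intro card_subset_eq) (auto simp: card_image[OF inj])
  then show ?thesis using inj by (simp add: bij_betw_def)
qed


section \<open>Flags, their frames, and their number\<close>

lemma invertible_transpose: "invertible (transpose A)" if "invertible (A :: 'f::field ^ 'd ^ 'd::finite)"
  using that by (meson invertible_def matrix_left_right_inverse right_invertible_transpose)

lemma matrix_inv_mult:
  fixes A :: "'f::field ^ 'd ^ 'd::finite"
  assumes "invertible A"
  shows "A ** matrix_inv A = mat 1" "matrix_inv A ** A = mat 1"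
  using someI_ex[OF assms[unfolded invertible_def]] by (auto simp: matrix_inv_def)

lemma invertible_matrix_inv: "invertible (matrix_inv A)" if "invertible (A :: 'f::field ^ 'd ^ 'd::finite)"
  using matrix_inv_mult[OF that] by (auto simp: invertible_def)

lemma matrix_inv_unique:
  fixes A :: "'f::field ^ 'd ^ 'd::finite"
  assumes "A ** B = mat 1"
  shows "matrix_inv A = B"
proof -
  have "invertible A" using assms by (auto simp: invertible_right_inverse)
  then have "matrix_inv A = matrix_inv A ** (A ** B)" using assms by simp
  also have "\<dots> = B" using matrix_inv_mult[OF \<open>invertible A\<close>] by (simp add: matrix_mul_assoc)
  finally show ?thesis .
qed

lemma matrix_vector_mult_axis:
  fixes A :: "'f::field ^ 'd ^ 'd::finite"
  shows "A *v axis j 1 = column j A"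
  by (simp add: vec_eq_iff matrix_vector_mult_def column_def axis_def if_distrib cong: if_cong)

lemma actX_mult: "actX (A ** B) V = actX A (actX B V)"
  by (simp add: actX_def image_image matrix_vector_mul_assoc)

lemma actX_mat_1: "actX (mat 1) V = V"
  by (simp add: actX_def)

lemma actX_inj:
  assumes "invertible g" "actX g V = actX g W"
  shows "V = W"
  using assms by (metis actX_mult actX_mat_1 matrix_inv_mult(2))

lemma length_actX [simp]: "length (actX g V) = length V"
  by (simp add: actX_def)

lemma nth_actX: "i < length V \<Longrightarrow> actX g V ! i = (*v) g ` (V ! i)"
  by (simp add: actX_def)

lemma card_image_invertible:
  "invertible (g :: 'f::field ^ 'd ^ 'd::finite) \<Longrightarrow> card ((*v) g ` S) = card S"
  by (meson card_image inj_matrix_vector_mult inj_on_subset subset_UNIV)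

lemma finite_Flag: "finite (Flag ds :: ('f::{field,finite} ^ 'd::finite) set list set)"
  by (rule finite_subset[OF _ finite_lists_length_eq[OF finite, of UNIV "length ds"]])
     (auto simp: Flag_def)

lemma actX_Flag:
  fixes g :: "'f::{field,finite} ^ 'd ^ 'd::finite"
  assumes "ds \<noteq> []" and g: "invertible g" and V: "V \<in> Flag ds"
  shows "actX g V \<in> Flag ds"
proof -
  have len: "length V = length ds" using V by (simp add: Flag_def)
  have sub: "vec.subspace ((*v) g ` (V ! i)) \<and> vec.dim ((*v) g ` (V ! i)) = psum ds i"
    if "i < length ds" for i
  proof -
    have Vi: "vec.subspace (V ! i)" "vec.dim (V ! i) = psum ds i"
      using V that by (auto simp: Flag_def)
    then have "vec.subspace ((*v) g ` (V ! i))" using vec.subspace_image by blast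
    then show ?thesis
      using dim_subspace_if_card card_subspace[OF Vi(1)] Vi(2) card_image_invertible[OF g] by metis
  qed
  have mono: "(*v) g ` (V ! i) \<subset> (*v) g ` (V ! Suc i)" if "Suc i < length ds" for i
  proof -
    have "V ! i \<subset> V ! Suc i" using V that by (auto simp: Flag_def)
    then show ?thesis using inj_matrix_vector_mult[OF g] by (simp add: psubset_eq inj_image_subset_iff inj_image_eq_iff)
  qed
  have "last (actX g V) = (*v) g ` last V"
    unfolding actX_def using assms(1) len by (intro last_map) auto
  also have "\<dots> = UNIV"
    using V finite_UNIV_inj_surj[OF _ inj_matrix_vector_mult[OF g]] by (simp add: Flag_def)
  finally show ?thesis using len sub mono by (simp add: Flag_def nth_actX)
qed

locale flag_type =
  fixes ds :: "nat list" and dim_type :: "'d::{finite,linorder} itself"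
  assumes pos: "\<forall>k\<in>set ds. k > 0" and sum_ds: "sum_list ds = CARD('d)"
begin

text \<open>
  The block of an index of the standard basis. A matrix is block upper triangular if it has no
  nonzero entry in a position whose row has a larger level than its column, and the members of the
  standard flag are cut out by a bound on the level.
\<close>

definition lev :: "'d \<Rightarrow> nat" where
  "lev j = block ds (rank_of j)"

definition E :: "nat \<Rightarrow> ('f::field ^ 'd::_) set" where
  "E i = {v. \<forall>k. i < lev k \<longrightarrow> v $ k = 0}"

abbreviation std :: "('f::field ^ 'd::_) set list" where
  "std \<equiv> std_flag ds"

lemma ds_nonempty: "ds \<noteq> []"
  using sum_ds by auto

lemma rank_of_less: "rank_of (j :: 'd) < sum_list ds"
  using bij_rank_of by (auto simp: sum_ds bij_betw_def)

lemma lev_le_iff: "lev j \<le> i \<longleftrightarrow> rank_of j < psum ds i"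
  unfolding lev_def by (rule block_le_iff[OF rank_of_less])

lemma lev_less: "lev j < length ds"
  unfolding lev_def by (rule block_less_length[OF rank_of_less])

lemma card_lev_le: "card {j. lev j \<le> i} = psum ds i"
proof -
  have "bij_betw rank_of {j :: 'd. lev j \<le> i} {..<psum ds i}"
    using bij_rank_of[where ?'d = 'd] psum_le[of ds i]
    by (auto simp: bij_betw_def lev_le_iff sum_ds inj_on_def image_iff set_eq_iff) 
       (metis order.strict_trans2 lessThan_iff)
  then show ?thesis by (simp add: bij_betw_same_card)
qed

lemma card_lev_eq:
  assumes "i < length ds"
  shows "card {j. lev j = i} = ds ! i"
proof (cases i)
  case 0
  then show ?thesis using card_lev_le[of 0] assms by (simp add: psum_def take_Suc_conv_app_nth)
next
  case (Suc m)
  have "{j. lev j = i} = {j. lev j \<le> i} - {j. lev j \<le> m}" using Suc by auto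
  then have "card {j. lev j = i} = card {j. lev j \<le> i} - card {j. lev j \<le> m}"
    using Suc by (simp add: card_Diff_subset Collect_mono_iff)
  then show ?thesis using psum_Suc[of m ds] assms Suc by (simp add: card_lev_le)
qed

lemma subspace_E: "vec.subspace (E i)"
  by (auto simp: E_def vec.subspace_def)

lemma card_E: "card (E i :: ('f::{field,finite} ^ 'd::_) set) = CARD('f) ^ psum ds i"
proof -
  have "bij_betw vec_lambda {f :: 'd \<Rightarrow> 'f. \<forall>k. k \<notin> {j. lev j \<le> i} \<longrightarrow> f k = 0} (E i)"
    by (rule bij_betwI[where g = vec_nth]) (auto simp: E_def)
  then show ?thesis
    using card_functions_prescribed_outside[of "{j. lev j \<le> i}" "\<lambda>_. 0 :: 'f"]
    by (simp add: bij_betw_same_card[symmetric] card_lev_le)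
qed

lemma E_mono: "i \<le> j \<Longrightarrow> E i \<subseteq> E j"
  by (auto simp: E_def)

lemma axis_in_E: "axis j 1 \<in> E i \<longleftrightarrow> lev j \<le> i"
  by (auto simp: E_def axis_def)

lemma span_axes_eq_E: "vec.span {axis j 1 | j. lev j \<le> i} = (E i :: ('f::field ^ 'd::_) set)"
proof
  show "vec.span {axis j 1 | j. lev j \<le> i} \<subseteq> (E i :: ('f ^ 'd::_) set)"
    by (rule vec.span_minimal) (auto simp: axis_in_E subspace_E)
  show "(E i :: ('f ^ 'd::_) set) \<subseteq> vec.span {axis j 1 | j. lev j \<le> i}"
  proof
    fix v :: "'f ^ 'd::_" assume v: "v \<in> E i"
    have "(\<Sum>j\<in>UNIV. v $ j *s axis j 1) \<in> vec.span {axis j 1 | j. lev j \<le> i}"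
    proof (rule vec.span_sum)
      fix j
      show "v $ j *s axis j 1 \<in> vec.span {axis j 1 | j. lev j \<le> i}"
      proof (cases "lev j \<le> i")
        case True
        then show ?thesis by (intro vec.span_scale vec.span_base) auto
      next
        case False
        then have "v $ j = 0" using v by (simp add: E_def)
        then show ?thesis by (simp add: vec.span_zero)
      qed
    qed
    then show "v \<in> vec.span {axis j 1 | j. lev j \<le> i}" by (simp only: basis_expansion)
  qed
qed

lemma std_eq: "std = map E [0..<length ds]"
  by (simp add: std_flag_def span_axes_eq_E[symmetric] lev_le_iff rank_of_def)

lemma length_std [simp]: "length std = length ds"
  by (simp add: std_eq)

lemma nth_std: "i < length ds \<Longrightarrow> std ! i = E i"
  by (simp add: std_eq)

lemma E_last: "length ds \<le> Suc i \<Longrightarrow> E i = UNIV"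
proof -
  assume "length ds \<le> Suc i"
  then have "\<not> i < lev k" for k using lev_less[of k] by simp
  then show ?thesis by (simp add: E_def)
qed

lemma std_Flag: "(std :: ('f::{field,finite} ^ 'd::_) set list) \<in> Flag ds"
proof -
  have "(E i :: ('f ^ 'd::_) set) \<subset> E (Suc i)" if "Suc i < length ds" for i
  proof -
    have "{j. lev j = Suc i} \<noteq> {}"
      using card_lev_eq[OF that] pos that by (metis card.empty nth_mem less_numeral_extra(3))
    then obtain j where "lev j = Suc i" by blast
    then have "axis j 1 \<in> (E (Suc i) :: ('f ^ 'd::_) set) - E i" by (simp add: axis_in_E)
    then have "(E i :: ('f ^ 'd::_) set) \<noteq> E (Suc i)" by blast
    moreover have "(E i :: ('f ^ 'd::_) set) \<subseteq> E (Suc i)" by (rule E_mono) simp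
    ultimately show ?thesis by (rule psubsetI[rotated])
  qed
  moreover have "vec.dim (E i :: ('f ^ 'd::_) set) = psum ds i" for i
    by (rule dim_subspace_if_card[OF subspace_E card_E])
  moreover have "last (std :: ('f ^ 'd::_) set list) = UNIV"
    using ds_nonempty by (simp add: last_conv_nth std_eq E_last)
  ultimately show ?thesis by (simp add: Flag_def nth_std subspace_E)
qed

lemma Flag_member_mono:
  assumes "V \<in> Flag ds" "i \<le> j" "j < length ds"
  shows "V ! i \<subseteq> V ! j"
  using assms(2,3)
proof (induction j rule: dec_induct)
  case (step m)
  moreover have "V ! m \<subset> V ! Suc m" using assms(1) step.prems by (simp add: Flag_def)
  ultimately show ?case by auto
qed simp

definition frames :: "('f::field ^ 'd::_) set list \<Rightarrow> ('f ^ 'd::_ ^ 'd::_) set" where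
  "frames V = {M. invertible M \<and> actX M std = V}"

text \<open>
  If the columns lie in the prescribed members, then \<open>M\<close> maps \<open>E i\<close> into \<open>V ! i\<close>; it maps onto it
  because both have the same finite size. Thus the frames of a flag are bases chosen along a chain of
  subspaces, and can be counted.
\<close>

lemma frame_iff_columns:
  fixes M :: "'f::{field,finite} ^ 'd::_ ^ 'd::_"
  assumes V: "V \<in> Flag ds" and M: "invertible M"
  shows "actX M std = V \<longleftrightarrow> (\<forall>j. column j M \<in> V ! lev j)"
proof
  assume "actX M std = V"
  then have "V ! lev j = (*v) M ` E (lev j)" for j
    using lev_less by (auto simp: nth_actX nth_std)
  moreover have "M *v axis j 1 \<in> (*v) M ` E (lev j)" for j
    by (rule imageI) (simp add: axis_in_E)
  ultimately show "\<forall>j. column j M \<in> V ! lev j"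
    by (simp add: matrix_vector_mult_axis)
next
  assume col: "\<forall>j. column j M \<in> V ! lev j"
  have "(*v) M ` E i = V ! i" if i: "i < length ds" for i
  proof (rule card_subset_eq)
    have Vi: "vec.subspace (V ! i)" "vec.dim (V ! i) = psum ds i"
      using V i by (auto simp: Flag_def)
    show "(*v) M ` E i \<subseteq> V ! i"
    proof safe
      fix v :: "'f ^ 'd::_" assume v: "v \<in> E i"
      have "(v $ j) *s column j M \<in> V ! i" for j
      proof (cases "lev j \<le> i")
        case True
        then have "column j M \<in> V ! i" using col Flag_member_mono[OF V _ i] by blast
        then show ?thesis using Vi(1) by (simp add: vec.subspace_scale)
      next
        case False
        then show ?thesis using v Vi(1) by (simp add: E_def vec.subspace_0)
      qed
      then show "M *v v \<in> V ! i"
        unfolding matrix_mult_sum by (intro vec.subspace_sum[OF Vi(1)])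
    qed
    show "card ((*v) M ` E i) = card (V ! i)"
      using card_subspace[OF Vi(1)] Vi(2) by (simp add: card_image_invertible[OF M] card_E)
  qed simp
  then show "actX M std = V"
    using V by (intro nth_equalityI) (auto simp: Flag_def nth_actX nth_std)
qed

lemma card_frames:
  fixes V :: "('f::{field,finite} ^ 'd::_) set list"
  assumes V: "V \<in> Flag ds"
  shows "card (frames V) = num_frames CARD('f) ds"
proof -
  let ?d = "sum_list ds"
  let ?W = "\<lambda>k. V ! block ds k"
  let ?mat = "\<lambda>l. (\<chi> a b. (l ! rank_of b) $ a) :: 'f ^ 'd::_ ^ 'd::_"
  have sub: "vec.subspace (?W k)" "vec.dim (?W k) = psum ds (block ds k)" if "k < ?d" for k
    using V block_less_length[OF that] by (auto simp: Flag_def)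
  have mono: "?W k \<subseteq> ?W l" if "k \<le> l" "l < ?d" for k l
  proof (rule Flag_member_mono[OF V _ block_less_length[OF that(2)]])
    have "l < psum ds (block ds l)" using block_le_iff[OF that(2)] by blast
    then show "block ds k \<le> block ds l" using that by (subst block_le_iff) auto
  qed
  have col: "column j (?mat l) = l ! rank_of j" for j l
    by (simp add: column_def vec_eq_iff)
  \<comment> \<open>The criterion is linear independence of the family of columns, which says that the list is repetition-free and that its set of entries is independent.\<close>
  have inv: "invertible (?mat l) \<longleftrightarrow> distinct l \<and> vec.independent (set l)" if l: "length l = ?d" for l
  proof -
    let ?h = "\<lambda>j :: 'd. l ! rank_of j"
    have bij: "bij_betw rank_of (UNIV :: 'd set) {..<?d}" using bij_rank_of by (simp add: sum_ds)
    have rng: "range ?h = set l"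
      using bij l by (auto simp: bij_betw_def set_conv_nth image_iff) (metis imageE lessThan_iff rangeI)
    have inj: "inj ?h \<longleftrightarrow> distinct l"
    proof -
      have "distinct l \<longleftrightarrow> inj_on ((!) l) {..<?d}"
        using l by (auto simp: distinct_conv_nth inj_on_def)
      also have "\<dots> \<longleftrightarrow> inj ((!) l \<circ> (rank_of :: 'd \<Rightarrow> nat))"
        using bij comp_inj_on_iff[of "rank_of :: 'd \<Rightarrow> nat" UNIV "(!) l"] unfolding bij_betw_def by simp
      finally show ?thesis by (simp add: comp_def)
    qed
    have "invertible (?mat l) \<longleftrightarrow> (\<forall>c. (\<Sum>j\<in>UNIV. c j *s ?h j) = 0 \<longrightarrow> (\<forall>j. c j = 0))"
      unfolding invertible_left_inverse matrix_left_invertible_independent_columns col ..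
    also have "\<dots> \<longleftrightarrow> inj ?h \<and> vec.independent (set l)"
    proof safe
      assume *: "\<forall>c. (\<Sum>j\<in>UNIV. c j *s ?h j) = 0 \<longrightarrow> (\<forall>j. c j = 0)"
      show **: "inj ?h"
      proof (rule injI, rule ccontr)
        fix a b :: 'd assume ab: "?h a = ?h b" "a \<noteq> b"
        let ?c = "\<lambda>j. if j = a then 1 else if j = b then - 1 else (0 :: 'f)"
        have "(\<Sum>j\<in>UNIV. ?c j *s ?h j) = (\<Sum>j\<in>{a, b}. ?c j *s ?h j)"
          by (rule sum.mono_neutral_right) auto
        also have "\<dots> = 0" using ab by simp
        finally have "\<forall>j. ?c j = 0" by (rule *[rule_format, THEN allI])
        from spec[OF this, of a] show False by simp
      qed
      show False if dep: "vec.dependent (set l)"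
      proof -
        obtain u v where u: "v \<in> set l" "u v \<noteq> 0" "(\<Sum>v\<in>set l. u v *s v) = 0"
          using dep by (auto simp: vec.dependent_finite)
        have "(\<Sum>j\<in>UNIV. u (?h j) *s ?h j) = 0"
          using u(3) sum.reindex[OF **, of "\<lambda>v. u v *s v"] by (simp add: rng)
        then have "u (?h j) = 0" for j using spec[OF *, of "\<lambda>j. u (?h j)"] by blast
        moreover obtain j where "v = ?h j" using u(1) rng by (metis imageE)
        ultimately show ?thesis using u(2) by simp
      qed
    next
      fix c j
      assume h: "inj ?h" and ind: "vec.independent (set l)" and z: "(\<Sum>j\<in>UNIV. c j *s ?h j) = 0"
      have ih: "inv_into UNIV ?h (l ! rank_of i) = i" for i using inv_into_f_f[OF h, of i] by simp
      have "(\<Sum>v\<in>set l. c (inv_into UNIV ?h v) *s v) = 0"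
        using z sum.reindex[OF h, of "\<lambda>v. c (inv_into UNIV ?h v) *s v"] by (simp add: rng ih)
      then have "c (inv_into UNIV ?h (?h j)) = 0"
        by (rule vec.independentD[OF ind finite_set subset_refl]) (use rng in blast)
      then show "c j = 0" by (simp only: ih)
    qed
    finally show ?thesis using inj by simp
  qed
  have "bij_betw ?mat (indep_lists ?W ?d) (frames V)"
    unfolding bij_betw_def
  proof
    have bij: "bij_betw rank_of (UNIV :: 'd set) {..<?d}" using bij_rank_of by (simp add: sum_ds)
    show "inj_on ?mat (indep_lists ?W ?d)"
    proof (rule inj_onI)
      fix l l' assume l: "l \<in> indep_lists ?W ?d" "l' \<in> indep_lists ?W ?d" "?mat l = ?mat l'"
      then have "l ! rank_of j = l' ! rank_of j" for j :: 'd by (metis col)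
      then have "l ! k = l' ! k" if "k < ?d" for k
        using bij that by (metis bij_betw_def imageE lessThan_iff)
      then show "l = l'" using l by (intro nth_equalityI) (auto simp: indep_lists_def)
    qed
    show "?mat ` indep_lists ?W ?d = frames V"
    proof (intro equalityI subsetI)
      fix M assume "M \<in> ?mat ` indep_lists ?W ?d"
      then obtain l where l: "M = ?mat l" "l \<in> indep_lists ?W ?d" by blast
      then have "invertible M" using inv by (simp add: indep_lists_def)
      moreover have "column j M \<in> V ! lev j" for j
        using l rank_of_less[of j] by (simp add: col indep_lists_def lev_def)
      ultimately show "M \<in> frames V" using frame_iff_columns[OF V] by (simp add: frames_def)
    next
      fix M assume M: "M \<in> frames V"
      define l where "l = map (\<lambda>k. column (inv_into UNIV rank_of k) M) [0..<?d]"
      have nth: "l ! rank_of j = column j M" for j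
        using bij rank_of_less[of j] by (simp add: l_def bij_betw_def)
      then have "M = ?mat l" by (simp add: vec_eq_iff column_def)
      moreover have "\<forall>j. column j M \<in> V ! lev j"
        using M frame_iff_columns[OF V] unfolding frames_def by blast
      then have "l ! rank_of j \<in> ?W (rank_of j)" for j :: 'd using nth by (simp add: lev_def)
      then have "l ! k \<in> ?W k" if "k < ?d" for k
        using bij that by (metis bij_betw_def imageE lessThan_iff)
      moreover have "length l = ?d" by (simp add: l_def)
      ultimately show "M \<in> ?mat ` indep_lists ?W ?d"
        using M inv by (auto simp: frames_def indep_lists_def)
    qed
  qed
  then have "card (frames V) = card (indep_lists ?W ?d)" by (simp add: bij_betw_same_card)
  also have "\<dots> = (\<Prod>k<?d. CARD('f) ^ vec.dim (?W k) - CARD('f) ^ k)"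
    using sub(1) mono by (rule card_indep_lists)
  also have "\<dots> = num_frames CARD('f) ds"
    unfolding num_frames_def using sub(2) by (intro prod.cong) auto
  finally show ?thesis .
qed

text \<open>
  Every invertible matrix is a frame of exactly one flag, the image of the standard flag.
\<close>

lemma card_GL_eq:
  "card (GL :: ('f::{field,finite} ^ 'd::_ ^ 'd::_) set) =
    card (Flag ds :: ('f ^ 'd::_) set list set) * num_frames CARD('f) ds"
proof -
  have eq: "(GL :: ('f ^ 'd::_ ^ 'd::_) set) = (\<Union>V\<in>Flag ds. frames V)"
    using actX_Flag[OF ds_nonempty _ std_Flag] by (auto simp: GL_def frames_def)
  have "card (\<Union>V\<in>Flag ds. frames V :: ('f ^ 'd::_ ^ 'd::_) set) = (\<Sum>V\<in>Flag ds. card (frames V :: ('f ^ 'd::_ ^ 'd::_) set))"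
    by (rule card_UN_disjoint[OF finite_Flag]) (auto simp: frames_def)
  then show ?thesis unfolding eq by (simp add: card_frames)
qed

end

text \<open>
  For the type \<open>[d]\<close> there is only one flag, so \<open>card_GL_eq\<close> for that type computes
  the order of the general linear group.
\<close>

lemma card_Flag:
  assumes "\<forall>k\<in>set ds. k > 0" "sum_list ds = CARD('d::{finite,linorder})"
  shows "real (card (Flag ds :: ('f::{field,finite} ^ 'd::{finite,linorder}) set list set)) =
    gauss_multinomial (real CARD('f)) (sum_list ds) ds"
proof -
  let ?q = "CARD('f)" and ?d = "sum_list ds"
  interpret flag_type ds "TYPE('d)" using assms by unfold_locales
  interpret triv: flag_type "[?d]" "TYPE('d)" using assms by unfold_locales auto
  have q: "?q > 1" using card_mono[of UNIV "{0, 1 :: 'f}"] by simp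
  have "(Flag [?d] :: ('f ^ 'd::_) set list set) = {[UNIV]}"
  proof -
    have single: "V = [UNIV]" if "V \<in> Flag [?d]" for V :: "('f ^ 'd::_) set list"
      using that by (auto simp: Flag_def length_Suc_conv)
    have "(triv.std :: ('f ^ 'd::_) set list) \<in> Flag [?d]" by (rule triv.std_Flag)
    then have "([UNIV] :: ('f ^ 'd::_) set list) \<in> Flag [?d]" using single by metis
    then show ?thesis using single by blast
  qed
  then have "card (Flag ds :: ('f ^ 'd::_) set list set) * num_frames ?q ds = num_frames ?q [?d]"
    using card_GL_eq[where ?'f = 'f] triv.card_GL_eq[where ?'f = 'f] by simp
  then have eq: "real (card (Flag ds :: ('f ^ 'd::_) set list set)) * real (num_frames ?q ds) = real (num_frames ?q [?d])"
    by (simp flip: of_nat_mult)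
  define N where "N = real (card (Flag ds :: ('f ^ 'd::_) set list set))"
  define c where "c = (\<Prod>k<?d. real ?q ^ k) * (real ?q - 1) ^ ?d"
  define Q where "Q = (\<Prod>k\<leftarrow>ds. qfact (real ?q) k)"
  have "real (num_frames ?q ds) = c * Q" "real (num_frames ?q [?d]) = c * qfact (real ?q) ?d"
    using num_frames_eq[OF q, of ds] num_frames_eq[OF q, of "[?d]"] by (simp_all add: c_def Q_def)
  moreover have "c * Q > 0" using num_frames_pos[OF q, of ds] calculation(1) by linarith
  moreover from this have "Q \<noteq> 0" "c \<noteq> 0" by auto
  ultimately have "N = qfact (real ?q) ?d / Q"
    using eq unfolding N_def[symmetric] by (auto simp: eq_divide_eq)
  then show ?thesis by (simp add: N_def Q_def gauss_multinomial_def)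
qed


section \<open>Principal minors and dilations\<close>

text \<open>
  Filling up with the identity outside \<open>S\<close> makes principal minors determinants of matrices of
  the full size, so that sizes need not vary with \<open>S\<close>.
\<close>

definition trunc :: "'d::finite set \<Rightarrow> 'f::comm_ring_1 ^ 'd ^ 'd \<Rightarrow> 'f ^ 'd ^ 'd" where
  "trunc S G = (\<chi> a b. if a \<in> S \<and> b \<in> S then G $ a $ b else if a = b then 1 else 0)"

definition minor :: "'d::finite set \<Rightarrow> 'f::comm_ring_1 ^ 'd ^ 'd \<Rightarrow> 'f" where
  "minor S G = det (trunc S G)"

text \<open>
  The condition on \<open>p\<close> says that \<open>p\<close> preserves the span of the standard basis vectors indexed by
  \<open>S\<close>; then only the block of \<open>G\<close> on \<open>S\<close> contributes to the block of \<open>G ** p\<close> on \<open>S\<close>.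
\<close>

lemma trunc_mult_right:
  assumes p: "\<And>a b. a \<notin> S \<Longrightarrow> b \<in> S \<Longrightarrow> p $ a $ b = 0"
  shows "trunc S (G ** p) = trunc S G ** trunc S p"
proof -
  have "trunc S (G ** p) $ a $ b = (\<Sum>k\<in>UNIV. trunc S G $ a $ k * trunc S p $ k $ b)" for a b
  proof (cases "a \<in> S")
    case True
    show ?thesis
    proof (cases "b \<in> S")
      case b: True
      have "trunc S G $ a $ k * trunc S p $ k $ b = G $ a $ k * p $ k $ b" for k
        using True b p by (auto simp: trunc_def)
      then show ?thesis using True b by (simp add: trunc_def matrix_matrix_mult_def)
    next
      case b: False
      have "trunc S G $ a $ k * trunc S p $ k $ b = 0" for k
        using True b by (auto simp: trunc_def)
      then show ?thesis using True b by (auto simp: trunc_def)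
    qed
  next
    case False
    then have "trunc S G $ a $ k * trunc S p $ k $ b = (if k = a then trunc S p $ a $ b else 0)" for k
      by (auto simp: trunc_def)
    then show ?thesis using False by (simp add: trunc_def)
  qed
  then show ?thesis by (simp add: vec_eq_iff matrix_matrix_mult_def)
qed

lemma trunc_transpose: "trunc S (transpose G) = transpose (trunc S G)"
  by (auto simp: trunc_def transpose_def vec_eq_iff)

lemma trunc_mat_1: "trunc S (mat 1) = mat 1"
  by (auto simp: trunc_def mat_def vec_eq_iff)

lemma minor_transpose: "minor S (transpose G) = minor S G"
  by (simp add: minor_def trunc_transpose det_transpose)

lemma minor_mat_1: "minor S (mat 1) = 1"
  by (simp add: minor_def trunc_mat_1)

lemma minor_mult_right:
  assumes "\<And>a b. a \<notin> S \<Longrightarrow> b \<in> S \<Longrightarrow> p $ a $ b = 0"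
  shows "minor S (G ** p) = minor S G * minor S p"
  unfolding minor_def by (simp add: trunc_mult_right[OF assms] det_mul)

text \<open>
  The matrix of \<open>u \<mapsto> u + (t - 1) (b \<cdot> u) a\<close>. If \<open>b \<cdot> a = 1\<close>, this multiplies \<open>a\<close> by \<open>t\<close> and is the
  identity on the hyperplane \<open>b \<cdot> u = 0\<close>.
\<close>

definition dilation :: "'f::comm_ring_1 \<Rightarrow> 'f ^ 'd \<Rightarrow> 'f ^ 'd \<Rightarrow> 'f ^ 'd ^ 'd::finite" where
  "dilation t a b = (\<chi> i j. (if i = j then 1 else 0) + (t - 1) * a $ i * b $ j)"

text \<open>
  Where \<open>b\<close> has a nonzero coordinate \<open>k\<close>, column operations with column \<open>k\<close> clear \<open>b\<close> in all other
  columns. Conjugating by these operations leaves the identity with only column \<open>k\<close> changed, whose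
  determinant is the diagonal entry of that column.
\<close>

lemma det_dilation:
  fixes a b :: "'f::field ^ 'd::finite"
  shows "det (dilation t a b) = 1 + (t - 1) * (\<Sum>k\<in>UNIV. b $ k * a $ k)"
proof (cases "b = 0")
  case True
  then have "dilation t a b = mat 1" by (simp add: dilation_def mat_def vec_eq_iff)
  then show ?thesis using True by simp
next
  case False
  then obtain k where k: "b $ k \<noteq> 0" by (auto simp: vec_eq_iff)
  define s where "s = t - 1"
  define c where "c = (\<chi> j. if j = k then 0 else b $ j / b $ k)"
  \<comment> \<open>the new column \<open>k\<close> after conjugation with \<open>C\<close>, the matrix of the column operations\<close>
  define x where "x = (\<chi> i. if i = k then 1 + s * (\<Sum>l\<in>UNIV. b $ l * a $ l) else s * b $ k * a $ i)"
  define C where "C = ((\<chi> i j. (if i = j then 1 else 0) - (if i = k then c $ j else 0)) :: 'f ^ 'd ^ 'd)"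
  define T where "T = ((\<chi> i j. if j = k then (mat 1 *v x) $ i else mat 1 $ i $ j) :: 'f ^ 'd ^ 'd)"
  have T: "det T = x $ k" unfolding T_def cramer_lemma by simp
  have "transpose C = (\<chi> i j. if j = k then (mat 1 *v (axis k 1 - c)) $ i else mat 1 $ i $ j)"
    unfolding matrix_vector_mul_lid by (auto simp: C_def transpose_def vec_eq_iff mat_def axis_def c_def)
  then have "det (transpose C) = (axis k 1 - c) $ k" by (simp only: cramer_lemma det_I mult_1_right)
  then have C: "det C = 1" by (simp add: det_transpose c_def axis_def)
  have cx: "(\<Sum>l\<in>UNIV. c $ l * x $ l) = s * (\<Sum>l\<in>UNIV. b $ l * a $ l) - s * b $ k * a $ k"
  proof -
    have "c $ l * x $ l = s * (b $ l * a $ l) - (if l = k then s * b $ k * a $ k else 0)" for l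
      using k by (simp add: c_def x_def)
    then show ?thesis by (simp add: sum_subtractf sum_distrib_left)
  qed
  have "dilation t a b ** C = C ** T"
  proof -
    have "(dilation t a b ** C) $ i $ j = (C ** T) $ i $ j" for i j
    proof -
      let ?M = "\<lambda>i j. (if i = j then 1 else 0) + s * a $ i * b $ j"
      have "(dilation t a b ** C) $ i $ j = (\<Sum>l\<in>UNIV. (if l = j then ?M i l else 0) - (if l = k then ?M i l * c $ j else 0))"
        unfolding matrix_matrix_mult_def dilation_def C_def s_def[symmetric]
        by (simp add: algebra_simps) (intro sum.cong, auto simp: algebra_simps)
      also have "\<dots> = ?M i j - ?M i k * c $ j" by (simp add: sum_subtractf)
      also have "\<dots> = T $ i $ j - (if i = k then (\<Sum>l\<in>UNIV. c $ l * T $ l $ j) else 0)"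
      proof (cases "j = k")
        case True
        then have "T $ l $ j = x $ l" for l by (simp add: T_def)
        then show ?thesis using True cx by (simp add: c_def x_def algebra_simps)
      next
        case False
        then have Tj: "T $ l $ j = (if l = j then 1 else 0)" for l by (simp add: T_def mat_def)
        have "(\<Sum>l\<in>UNIV. c $ l * T $ l $ j) = (\<Sum>l\<in>UNIV. if l = j then c $ l else 0)"
          by (intro sum.cong) (auto simp: Tj)
        then have "(\<Sum>l\<in>UNIV. c $ l * T $ l $ j) = c $ j" by simp
        then show ?thesis using False k Tj by (simp add: c_def field_simps)
      qed
      also have "\<dots> = (\<Sum>l\<in>UNIV. (if l = i then T $ l $ j else 0) - (if i = k then c $ l * T $ l $ j else 0))"
        by (simp add: sum_subtractf)
      also have "\<dots> = (C ** T) $ i $ j"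
        unfolding matrix_matrix_mult_def C_def by simp (intro sum.cong, auto simp: algebra_simps)
      finally show ?thesis .
    qed
    then show ?thesis by (simp add: vec_eq_iff)
  qed
  then have "det (dilation t a b) * det C = det C * det T" by (metis det_mul)
  then show ?thesis using C T by (simp add: x_def s_def)
qed

text \<open>
  Truncating a dilation amounts to truncating the two vectors that define it.
\<close>

lemma minor_dilation:
  fixes a b :: "'f::field ^ 'd::finite"
  shows "minor S (dilation t a b) = 1 + (t - 1) * (\<Sum>k\<in>S. b $ k * a $ k)"
proof -
  let ?r = "\<lambda>v :: 'f ^ 'd. \<chi> i. if i \<in> S then v $ i else 0"
  have "trunc S (dilation t a b) = dilation t (?r a) (?r b)"
    by (auto simp: trunc_def dilation_def vec_eq_iff)
  moreover have "(\<Sum>k\<in>UNIV. ?r b $ k * ?r a $ k) = (\<Sum>k\<in>S. b $ k * a $ k)"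
    by (simp add: if_distrib sum.If_cases cong: if_cong)
  ultimately show ?thesis by (simp add: minor_def det_dilation)
qed

lemma sum_matrix_vector_transpose:
  fixes A :: "'f::comm_ring_1 ^ 'd ^ 'd::finite"
  shows "(\<Sum>k\<in>UNIV. (transpose A *v b) $ k * a $ k) = (\<Sum>k\<in>UNIV. b $ k * (A *v a) $ k)"
proof -
  have "(\<Sum>k\<in>UNIV. (transpose A *v b) $ k * a $ k) = (\<Sum>k\<in>UNIV. \<Sum>l\<in>UNIV. b $ l * (A $ l $ k * a $ k))"
    by (simp add: matrix_vector_mult_def transpose_def sum_distrib_left sum_distrib_right mult_ac)
  also have "\<dots> = (\<Sum>l\<in>UNIV. \<Sum>k\<in>UNIV. b $ l * (A $ l $ k * a $ k))" by (rule sum.swap)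
  also have "\<dots> = (\<Sum>k\<in>UNIV. b $ k * (A *v a) $ k)"
    by (simp add: matrix_vector_mult_def sum_distrib_left)
  finally show ?thesis .
qed

text \<open>
  Conjugation moves the axis of a dilation forward and its hyperplane accordingly; this form avoids
  the inverse of \<open>A\<close>.
\<close>

lemma mult_dilation:
  fixes A :: "'f::comm_ring_1 ^ 'd ^ 'd::finite"
  shows "A ** dilation t a (transpose A *v b) = dilation t (A *v a) b ** A"
proof -
  have "(A ** dilation t a (transpose A *v b)) $ i $ j = (dilation t (A *v a) b ** A) $ i $ j" for i j
  proof -
    define B where "B = (transpose A *v b) $ j"
    have "(A ** dilation t a (transpose A *v b)) $ i $ j =
        (\<Sum>k\<in>UNIV. (if k = j then A $ i $ k else 0) + (t - 1) * (A $ i $ k * a $ k) * B)"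
      unfolding matrix_matrix_mult_def dilation_def B_def[symmetric] vec_lambda_beta
      by (intro sum.cong) (auto simp: B_def algebra_simps)
    also have "\<dots> = A $ i $ j + (t - 1) * (A *v a) $ i * B"
      by (simp add: sum.distrib matrix_vector_mult_def sum_distrib_left sum_distrib_right)
    also have "\<dots> = (\<Sum>k\<in>UNIV. (if k = i then A $ k $ j else 0) + (t - 1) * (A *v a) $ i * (A $ k $ j * b $ k))"
      by (simp add: B_def sum.distrib matrix_vector_mult_def transpose_def sum_distrib_left)
    also have "\<dots> = (dilation t (A *v a) b ** A) $ i $ j"
      unfolding matrix_matrix_mult_def dilation_def B_def[symmetric] vec_lambda_beta
      by (intro sum.cong) (auto simp: B_def algebra_simps)
    finally show ?thesis .
  qed
  then show ?thesis by (simp add: vec_eq_iff)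
qed

context flag_type
begin

text \<open>
  Block upper triangular matrices; the invertible ones form the stabilizer of the standard flag
  (\<open>actX_std_iff_upper\<close>).
\<close>

definition upper :: "'f::field ^ 'd::_ ^ 'd::_ \<Rightarrow> bool" where
  "upper p \<longleftrightarrow> (\<forall>a b. lev b < lev a \<longrightarrow> p $ a $ b = 0)"

definition minor_prod :: "'f::field ^ 'd::_ ^ 'd::_ \<Rightarrow> 'f" where
  "minor_prod G = (\<Prod>i<length ds. minor {j. lev j \<le> i} G)"

lemma actX_std_iff_upper:
  fixes p :: "'f::{field,finite} ^ 'd::_ ^ 'd::_"
  assumes "invertible p"
  shows "actX p std = std \<longleftrightarrow> upper p"
  unfolding frame_iff_columns[OF std_Flag assms]
  by (auto simp: nth_std[OF lev_less] E_def column_def upper_def)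

lemma minor_prod_mult_right: "upper p \<Longrightarrow> minor_prod (G ** p) = minor_prod G * minor_prod p"
  unfolding minor_prod_def prod.distrib[symmetric]
  by (intro prod.cong refl minor_mult_right) (auto simp: upper_def)

lemma minor_prod_transpose: "minor_prod (transpose G) = minor_prod G"
  by (simp add: minor_prod_def minor_transpose)

lemma minor_prod_mult_left:
  assumes "upper p"
  shows "minor_prod (transpose p ** G) = minor_prod p * minor_prod G"
proof -
  have "minor_prod (transpose p ** G) = minor_prod (transpose (transpose p ** G))"
    by (simp add: minor_prod_transpose)
  also have "transpose (transpose p ** G) = transpose G ** p"
    by (simp add: matrix_transpose_mul)
  finally show ?thesis
    using assms by (simp add: minor_prod_mult_right minor_prod_transpose)
qed

lemma upper_matrix_inv:
  fixes p :: "'f::{field,finite} ^ 'd::_ ^ 'd::_"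
  assumes "invertible p" "upper p"
  shows "upper (matrix_inv p)"
proof -
  have "actX (matrix_inv p) (actX p std) = std"
    using matrix_inv_mult(2)[OF assms(1)] by (simp add: actX_mat_1 flip: actX_mult)
  then show ?thesis
    using assms actX_std_iff_upper invertible_matrix_inv[OF assms(1)] by metis
qed

lemma minor_prod_upper_nonzero:
  fixes p :: "'f::{field,finite} ^ 'd::_ ^ 'd::_"
  assumes "invertible p" "upper p"
  shows "minor_prod p \<noteq> 0"
proof -
  have "minor_prod p * minor_prod (matrix_inv p) = minor_prod (mat 1)"
    using minor_prod_mult_right[OF upper_matrix_inv[OF assms], of p] matrix_inv_mult(1)[OF assms(1)] by simp
  also have "\<dots> = 1" by (simp add: minor_prod_def minor_mat_1)
  finally show ?thesis by auto
qed

text \<open>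
  The assumption on \<open>V\<close> says that the dilation fixes each member of the flag: it either contains the
  axis \<open>v\<close> or lies in the hyperplane. In the coordinates of a frame, the restriction of the dilation to
  a member has determinant \<open>t\<close> in the first case and 1 in the second. Hence \<open>minor_prod\<close>
  counts, in the exponent of \<open>t\<close>, the members that contain \<open>v\<close>.
\<close>

lemma dilation_in_frame:
  fixes M :: "'f::{field,finite} ^ 'd::_ ^ 'd::_"
  assumes M: "M \<in> frames V" and t: "t \<noteq> 0" and bv: "(\<Sum>k\<in>UNIV. b $ k * v $ k) = 1"
    and V: "\<And>i. i < length ds \<Longrightarrow> v \<in> V ! i \<or> (\<forall>u \<in> V ! i. (\<Sum>k\<in>UNIV. b $ k * u $ k) = 0)"
  defines "p \<equiv> dilation t (matrix_inv M *v v) (transpose M *v b)"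
  shows "invertible p" "upper p" "M ** p = dilation t v b ** M"
    and "minor_prod p = t ^ card {i. i < length ds \<and> v \<in> V ! i}"
proof -
  define a where "a = matrix_inv M *v v"
  define c where "c = transpose M *v b"
  have inv: "invertible M" and act: "actX M std = V" using M by (auto simp: frames_def)
  have Ma: "M *v a = v"
    using matrix_inv_mult(1)[OF inv] by (simp add: a_def matrix_vector_mul_assoc)
  have p: "p = dilation t a c" by (simp add: p_def a_def c_def)
  show "M ** p = dilation t v b ** M"
    using mult_dilation[of M t a b] by (simp add: p c_def Ma)
  have ca: "(\<Sum>k\<in>UNIV. c $ k * a $ k) = 1"
    using bv unfolding c_def sum_matrix_vector_transpose Ma .
  have "det p = t" by (simp add: p det_dilation ca)
  then show "invertible p" using t by (simp add: invertible_det_nz)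
  have V_eq: "V ! i = (*v) M ` E i" if "i < length ds" for i
    using act that by (auto simp: nth_actX nth_std)
  have aE: "a \<in> E i" if i: "i < length ds" "v \<in> V ! i" for i
  proof -
    obtain u where u: "u \<in> E i" "v = M *v u" using i(2) unfolding V_eq[OF i(1)] by blast
    then have "a = u" using inj_matrix_vector_mult[OF inv] Ma by (metis injD)
    then show ?thesis using u by simp
  qed
  have c0: "c $ j = 0" if "i < length ds" "v \<notin> V ! i" "lev j \<le> i" for i j
  proof -
    have "M *v axis j 1 \<in> V ! i" using that by (auto simp: V_eq axis_in_E)
    then have "(\<Sum>k\<in>UNIV. b $ k * (M *v axis j 1) $ k) = 0" using V that by blast
    then have "(\<Sum>k\<in>UNIV. c $ k * (axis j 1 :: 'f ^ 'd::_) $ k) = 0"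
      unfolding c_def sum_matrix_vector_transpose .
    then show ?thesis by (simp add: axis_def if_distrib cong: if_cong)
  qed
  show "upper p"
    unfolding upper_def
  proof (intro allI impI)
    fix x y assume xy: "lev y < lev x"
    have "a $ x = 0 \<or> c $ y = 0"
      using aE[OF lev_less, of y] c0[OF lev_less, of y y] xy by (auto simp: E_def)
    then show "p $ x $ y = 0" using xy by (auto simp: p dilation_def)
  qed
  have "minor {j. lev j \<le> i} p = (if v \<in> V ! i then t else 1)" if i: "i < length ds" for i
  proof (cases "v \<in> V ! i")
    case True
    have "(\<Sum>k | lev k \<le> i. c $ k * a $ k) = (\<Sum>k\<in>UNIV. c $ k * a $ k)"
      using aE[OF i True] by (intro sum.mono_neutral_left) (auto simp: E_def)
    then show ?thesis using True ca by (simp add: p minor_dilation)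
  next
    case False
    then have "(\<Sum>k | lev k \<le> i. c $ k * a $ k) = 0"
      using c0[OF i] by (intro sum.neutral) auto
    then show ?thesis using False by (simp add: p minor_dilation)
  qed
  then have "minor_prod p = (\<Prod>i<length ds. if v \<in> V ! i then t else 1)"
    by (simp add: minor_prod_def)
  also have "\<dots> = t ^ card {i. i < length ds \<and> v \<in> V ! i}"
    by (simp add: prod.If_cases Int_def)
  finally show "minor_prod p = t ^ card {i. i < length ds \<and> v \<in> V ! i}" .
qed

end


section \<open>Relative position of two flags\<close>

context flag_type
begin

definition frame :: "('f::{field,finite} ^ 'd::_) set list \<Rightarrow> 'f ^ 'd::_ ^ 'd::_" where
  "frame V = (SOME M. M \<in> frames V)"

lemma frame:
  fixes V :: "('f::{field,finite} ^ 'd::_) set list"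
  assumes "V \<in> Flag ds"
  shows "frame V \<in> frames V" "invertible (frame V)" "actX (frame V) std = V"
proof -
  have "CARD('f) > 1" using card_mono[of UNIV "{0, 1 :: 'f}"] by simp
  then have "card (frames V) > 0" using card_frames[OF assms] num_frames_pos by simp
  then have "frames V \<noteq> {}" by (metis card.empty less_irrefl)
  then show "frame V \<in> frames V" unfolding frame_def by (simp add: some_in_eq)
  then show "invertible (frame V)" "actX (frame V) std = V" by (auto simp: frames_def)
qed

text \<open>
  The pairing of the vectors of a frame of \<open>V\<close> with those of a frame of \<open>W\<close>. Its leading minors detect
  whether the members of \<open>V\<close> and \<open>W\<close> are in perfect duality under the standard bilinear form.
\<close>

definition gram :: "('f::{field,finite} ^ 'd::_) set list \<Rightarrow> ('f ^ 'd::_) set list \<Rightarrow> 'f ^ 'd::_ ^ 'd::_" where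
  "gram V W = transpose (frame V) ** frame W"

text \<open>
  A linear map \<open>g\<close> carries a frame of \<open>V\<close> to a frame of \<open>g V\<close>, in general not the chosen one; the cocycle
  is the block upper triangular matrix that corrects the difference.
\<close>

definition cocycle :: "'f::{field,finite} ^ 'd::_ ^ 'd::_ \<Rightarrow> ('f ^ 'd::_) set list \<Rightarrow> 'f ^ 'd::_ ^ 'd::_" where
  "cocycle g V = matrix_inv (frame (actX g V)) ** g ** frame V"

lemma cocycle:
  fixes g :: "'f::{field,finite} ^ 'd::_ ^ 'd::_"
  assumes g: "invertible g" and V: "V \<in> Flag ds"
  shows "invertible (cocycle g V)" "upper (cocycle g V)" "frame (actX g V) ** cocycle g V = g ** frame V"
proof -
  note gV = frame[OF actX_Flag[OF ds_nonempty g V]]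
  show inv: "invertible (cocycle g V)"
    unfolding cocycle_def using g frame(2)[OF V] gV(2) by (intro invertible_mult invertible_matrix_inv)
  show eq: "frame (actX g V) ** cocycle g V = g ** frame V"
    using matrix_inv_mult(1)[OF gV(2)] by (simp add: cocycle_def matrix_mul_assoc)
  have "actX (cocycle g V) std = actX (matrix_inv (frame (actX g V))) (actX g V)"
    using frame(3)[OF V] by (simp add: cocycle_def actX_mult)
  also have "\<dots> = actX (matrix_inv (frame (actX g V)) ** frame (actX g V)) std"
    using gV(3) by (simp add: actX_mult)
  finally have "actX (cocycle g V) std = std"
    by (simp add: matrix_inv_mult(2)[OF gV(2)] actX_mat_1)
  then show "upper (cocycle g V)" using inv actX_std_iff_upper by blast
qed

text \<open>
  Since \<open>h\<close> is the contragredient of \<open>g\<close>, the pairing of \<open>g ** frame V\<close> with \<open>h ** frame W\<close> is again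
  \<open>gram V W\<close>. Replacing these frames by the chosen ones costs one cocycle on either side, and
  \<open>minor_prod\<close> is multiplicative for those.
\<close>

lemma gram_equivariant:
  fixes g :: "'f::{field,finite} ^ 'd::_ ^ 'd::_"
  assumes g: "invertible g" and VW: "V \<in> Flag ds" "W \<in> Flag ds"
  defines "h \<equiv> transpose (matrix_inv g)"
  shows "minor_prod (cocycle g V) * minor_prod (gram (actX g V) (actX h W)) * minor_prod (cocycle h W)
    = minor_prod (gram V W)"
proof -
  have h: "invertible h" unfolding h_def by (intro invertible_transpose invertible_matrix_inv g)
  note cV = cocycle[OF g VW(1)] and cW = cocycle[OF h VW(2)]
  have gh: "transpose g ** h = mat 1"
    unfolding h_def matrix_transpose_mul[symmetric] by (simp add: matrix_inv_mult[OF g] transpose_mat)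
  have "transpose (cocycle g V) ** gram (actX g V) (actX h W) ** cocycle h W
      = transpose (frame (actX g V) ** cocycle g V) ** (frame (actX h W) ** cocycle h W)"
    by (simp add: gram_def matrix_transpose_mul matrix_mul_assoc)
  also have "\<dots> = transpose (frame V) ** (transpose g ** h) ** frame W"
    unfolding cV(3) cW(3) by (simp add: matrix_transpose_mul matrix_mul_assoc)
  also have "\<dots> = gram V W" by (simp add: gh gram_def)
  finally show ?thesis
    by (metis minor_prod_mult_left[OF cV(2)] minor_prod_mult_right[OF cW(2)])
qed

definition lower_unipotent :: "('f::field ^ 'd::_ ^ 'd::_) set" where
  "lower_unipotent = {u. \<forall>a b. lev a \<le> lev b \<longrightarrow> u $ a $ b = (if a = b then 1 else 0)}"

text \<open>
  Forward substitution. The bound \<open>m\<close> allows it to be applied to a solution of which only the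
  equations in the levels up to \<open>m\<close> are known.
\<close>

lemma lower_unipotent_kernel:
  assumes u: "u \<in> lower_unipotent" and z: "\<And>a. lev a \<le> m \<Longrightarrow> (u *v w) $ a = 0"
  shows "lev a \<le> m \<Longrightarrow> w $ a = 0"
proof (induction "lev a" arbitrary: a rule: less_induct)
  case less
  have "u $ a $ b * w $ b = (if b = a then w $ a else 0)" for b
  proof (cases "lev b < lev a")
    case True
    then show ?thesis using less by auto
  next
    case False
    then show ?thesis using u by (auto simp: lower_unipotent_def)
  qed
  then have "(u *v w) $ a = w $ a" by (simp add: matrix_vector_mult_def)
  then show ?case using z less.prems by simp
qed

lemma lower_unipotent_invertible:
  assumes u: "u \<in> lower_unipotent"
  shows "invertible u"
proof -
  have "w = 0" if "u *v w = 0" for w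
    using lower_unipotent_kernel[OF u, of "Max (range lev)" w] that by (auto simp: vec_eq_iff)
  then show ?thesis by (simp add: invertible_left_inverse matrix_left_invertible_ker)
qed

lemma lower_unipotent_transpose_upper: "u \<in> lower_unipotent \<Longrightarrow> upper (transpose u)"
  by (auto simp: lower_unipotent_def upper_def transpose_def)

text \<open>
  Column \<open>b\<close> of \<open>u\<close> is the only vector in the member of index \<open>lev b\<close> of the common flag whose coordinates
  of level at most \<open>lev b\<close> agree with those of the \<open>b\<close>-th standard basis vector.
\<close>

lemma lower_unipotent_orbit_inj:
  fixes u w :: "'f::{field,finite} ^ 'd::_ ^ 'd::_"
  assumes u: "u \<in> lower_unipotent" and w: "w \<in> lower_unipotent" and eq: "actX u std = actX w std"
  shows "u = w"
proof -
  have "column b u = column b w" for b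
  proof -
    have "(*v) u ` E (lev b) = (*v) w ` E (lev b)"
      using arg_cong[OF eq, of "\<lambda>V. V ! lev b"] lev_less by (simp add: nth_actX nth_std)
    moreover have "u *v axis b 1 \<in> (*v) u ` E (lev b)" by (rule imageI) (simp add: axis_in_E)
    ultimately obtain c where c: "c \<in> E (lev b)" "u *v axis b 1 = w *v c" by auto
    have "(w *v (c - axis b 1)) $ a = 0" if "lev a \<le> lev b" for a
      using that u w by (simp add: matrix_vector_mult_diff_distrib flip: c(2))
        (simp add: matrix_vector_mult_axis column_def lower_unipotent_def)
    from lower_unipotent_kernel[OF w this]
    have "(c - axis b 1) $ a = 0" if "lev a \<le> lev b" for a using that by blast
    moreover have "(c - axis b 1) $ a = 0" if "\<not> lev a \<le> lev b" for a
      using c(1) that by (auto simp: E_def axis_def)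
    ultimately have "c = axis b 1" by (metis eq_iff_diff_eq_0 vec_eq_iff vector_minus_component)
    then show ?thesis using c(2) by (simp add: matrix_vector_mult_axis)
  qed
  then show ?thesis by (simp add: vec_eq_iff column_def)
qed

text \<open>
  The block LU decomposition, in the form that the flag spanned by the columns of \<open>G\<close> has a
  unipotent representative. A nonzero minor means that the member of index \<open>lev b\<close> of this flag projects
  isomorphically to the coordinates of level at most \<open>lev b\<close>; the column \<open>b\<close> of the representative is the
  preimage of the \<open>b\<close>-th standard basis vector.
\<close>

lemma ex_lower_unipotent:
  fixes G :: "'f::{field,finite} ^ 'd::_ ^ 'd::_"
  assumes G: "invertible G" and nz: "minor_prod G \<noteq> 0"
  shows "\<exists>u\<in>lower_unipotent. actX u std = actX G std"
proof -
  have "\<exists>c. c \<in> E (lev b) \<and> (\<forall>a. lev a \<le> lev b \<longrightarrow> (G *v c) $ a = (if a = b then 1 else 0))" for b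
  proof -
    let ?S = "{j. lev j \<le> lev b}"
    have "det (trunc ?S G) \<noteq> 0"
      using nz lev_less[of b] by (auto simp: minor_prod_def minor_def)
    then have inv: "invertible (trunc ?S G)" by (simp add: invertible_det_nz)
    define c where "c = matrix_inv (trunc ?S G) *v axis b 1"
    have tc: "trunc ?S G *v c = axis b 1"
      using matrix_inv_mult(1)[OF inv] by (simp add: c_def matrix_vector_mul_assoc)
    have cE: "c $ a = 0" if "\<not> lev a \<le> lev b" for a
    proof -
      have "trunc ?S G $ a $ k * c $ k = (if k = a then c $ a else 0)" for k
        using that by (auto simp: trunc_def)
      then have "(trunc ?S G *v c) $ a = c $ a" by (simp add: matrix_vector_mult_def)
      then show ?thesis using that by (auto simp: tc axis_def split: if_splits)
    qed
    moreover have "(G *v c) $ a = (if a = b then 1 else 0)" if "lev a \<le> lev b" for a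
    proof -
      have "G $ a $ k * c $ k = trunc ?S G $ a $ k * c $ k" for k
        using that cE[of k] by (auto simp: trunc_def)
      then have "(G *v c) $ a = (trunc ?S G *v c) $ a"
        unfolding matrix_vector_mult_def vec_lambda_beta by (intro sum.cong refl)
      then show ?thesis by (simp add: tc axis_def)
    qed
    ultimately show ?thesis by (intro exI[of _ c]) (auto simp: E_def)
  qed
  then obtain c where c: "\<And>b. c b \<in> E (lev b)"
    "\<And>a b. lev a \<le> lev b \<Longrightarrow> (G *v c b) $ a = (if a = b then 1 else 0)" by metis
  define C where "C = (\<chi> a b. c b $ a)"
  have col: "column b C = c b" for b by (simp add: C_def column_def vec_eq_iff)
  have GC: "G ** C \<in> lower_unipotent"
  proof -
    have "(G ** C) $ a $ b = (G *v c b) $ a" for a b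
      by (simp add: matrix_matrix_mult_def matrix_vector_mult_def C_def)
    then show ?thesis using c(2) by (simp add: lower_unipotent_def)
  qed
  then have "invertible (matrix_inv G ** (G ** C))"
    using lower_unipotent_invertible invertible_matrix_inv[OF G] by (blast intro: invertible_mult)
  then have "invertible C" by (simp add: matrix_mul_assoc matrix_inv_mult[OF G])
  moreover have "upper C" using c(1) by (auto simp: upper_def C_def E_def)
  ultimately have "actX C std = std" using actX_std_iff_upper by blast
  then have "actX (G ** C) std = actX G std" by (simp add: actX_mult)
  then show ?thesis using GC by blast
qed

lemma frame_mult_upper:
  fixes M :: "'f::{field,finite} ^ 'd::_ ^ 'd::_"
  assumes M: "invertible M"
  shows "\<exists>p. invertible p \<and> upper p \<and> frame (actX M std) = M ** p"
proof -
  let ?V = "actX M std :: ('f ^ 'd::_) set list"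
  have V: "?V \<in> Flag ds" by (rule actX_Flag[OF ds_nonempty M std_Flag])
  let ?p = "matrix_inv M ** frame ?V"
  have inv: "invertible ?p"
    using frame(2)[OF V] M by (intro invertible_mult invertible_matrix_inv)
  have "actX ?p std = actX (matrix_inv M) ?V" using frame(3)[OF V] by (simp add: actX_mult)
  also have "\<dots> = std" by (simp add: matrix_inv_mult(2)[OF M] actX_mat_1 flip: actX_mult)
  finally have "upper ?p" using inv actX_std_iff_upper by blast
  moreover have "frame ?V = M ** ?p" by (simp add: matrix_mul_assoc matrix_inv_mult(1)[OF M])
  ultimately show ?thesis using inv by blast
qed

text \<open>
  The columns of \<open>gram V W\<close> span the image of the flag \<open>W\<close> under the transposed frame of \<open>V\<close>. If the minors are
  nonzero, this image has exactly one unipotent representative, and every unipotent matrix arises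
  in this way.
\<close>

lemma opposite_flags:
  fixes V :: "('f::{field,finite} ^ 'd::_) set list"
  assumes V: "V \<in> Flag ds"
  shows "bij_betw (\<lambda>u. actX (matrix_inv (transpose (frame V)) ** u) std) lower_unipotent
    {W \<in> Flag ds. minor_prod (gram V W) \<noteq> 0}"
proof -
  let ?T = "transpose (frame V)"
  let ?h = "\<lambda>u. actX (matrix_inv ?T ** u) std :: ('f ^ 'd::_) set list"
  have T: "invertible ?T" by (rule invertible_transpose[OF frame(2)[OF V]])
  have Ti: "invertible (matrix_inv ?T)" by (rule invertible_matrix_inv[OF T])
  have hinv: "invertible (matrix_inv ?T ** u)" if "u \<in> lower_unipotent" for u
    by (rule invertible_mult[OF Ti lower_unipotent_invertible[OF that]])
  have "inj_on ?h lower_unipotent"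
  proof (rule inj_onI)
    fix u w :: "'f ^ 'd::_ ^ 'd::_"
    assume uw: "u \<in> lower_unipotent" "w \<in> lower_unipotent" "?h u = ?h w"
    then have "actX u std = actX w std" using actX_inj[OF Ti] by (simp add: actX_mult)
    then show "u = w" by (rule lower_unipotent_orbit_inj[OF uw(1,2)])
  qed
  moreover have "?h u \<in> Flag ds \<and> minor_prod (gram V (?h u)) \<noteq> 0" if u: "u \<in> lower_unipotent" for u
  proof
    show "?h u \<in> Flag ds" by (rule actX_Flag[OF ds_nonempty hinv[OF u] std_Flag])
    obtain p where p: "invertible p" "upper p" "frame (?h u) = matrix_inv ?T ** u ** p"
      using frame_mult_upper[OF hinv[OF u]] by blast
    have "gram V (?h u) = (?T ** matrix_inv ?T) ** u ** p"
      unfolding gram_def p(3) by (simp add: matrix_mul_assoc)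
    then have "minor_prod (gram V (?h u)) = minor_prod (transpose u) * minor_prod p"
      by (simp add: matrix_inv_mult(1)[OF T] minor_prod_mult_right[OF p(2)] minor_prod_transpose)
    then show "minor_prod (gram V (?h u)) \<noteq> 0"
      using minor_prod_upper_nonzero[OF p(1,2)]
        minor_prod_upper_nonzero[OF invertible_transpose[OF lower_unipotent_invertible[OF u]] lower_unipotent_transpose_upper[OF u]]
      by simp
  qed
  moreover have "W \<in> ?h ` lower_unipotent" if W: "W \<in> Flag ds" "minor_prod (gram V W) \<noteq> 0" for W
  proof -
    have "invertible (gram V W)" unfolding gram_def by (rule invertible_mult[OF T frame(2)[OF W(1)]])
    then obtain u where u: "u \<in> lower_unipotent" "actX u std = actX (gram V W) std"
      using ex_lower_unipotent W(2) by blast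
    have "?h u = actX (matrix_inv ?T ** ?T ** frame W) std"
      unfolding actX_mult[of _ u] u(2) by (simp add: gram_def matrix_mul_assoc flip: actX_mult)
    also have "\<dots> = W" by (simp add: matrix_inv_mult(2)[OF T] frame(3)[OF W(1)])
    finally show ?thesis using u(1) by (intro image_eqI[of _ _ u]) simp_all
  qed
  ultimately show ?thesis unfolding bij_betw_def by blast
qed

text \<open>
  Along the orbit, \<open>gram_equivariant\<close> changes the product of the minors only by nonzero factors, and it is
  nonzero at the standard pair. Conversely, if \<open>W\<close> is represented by the unipotent \<open>u\<close>, then \<open>V\<close> and \<open>W\<close>
  are simultaneously moved to the standard flags by a matrix that corrects the frame of \<open>V\<close> by the
  transpose of \<open>u\<close>, which stabilizes the standard flag.
\<close>

lemma std_orbit_iff: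
  fixes V W :: "('f::{field,finite} ^ 'd::_) set list"
  assumes V: "V \<in> Flag ds" and W: "W \<in> Flag ds"
  shows "(V, W) \<in> std_orbit ds \<longleftrightarrow> minor_prod (gram V W) \<noteq> 0"
proof
  assume "(V, W) \<in> std_orbit ds"
  then obtain g where g: "invertible g" "V = actX g std" "W = actX (transpose (matrix_inv g)) std"
    by (auto simp: std_orbit_def GL_def actY_def)
  have one: "invertible (mat 1 :: 'f ^ 'd::_ ^ 'd::_)" by (auto simp: invertible_def)
  obtain p :: "'f ^ 'd::_ ^ 'd::_" where p: "invertible p" "upper p" "frame std = p"
    using frame_mult_upper[OF one] by (auto simp: actX_mat_1)
  have "minor_prod (gram (std :: ('f ^ 'd::_) set list) std) = minor_prod p * minor_prod p"
    using p by (simp add: gram_def minor_prod_mult_right minor_prod_transpose)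
  then have "minor_prod (gram (std :: ('f ^ 'd::_) set list) std) \<noteq> 0" using minor_prod_upper_nonzero[OF p(1,2)] by simp
  then show "minor_prod (gram V W) \<noteq> 0"
    using gram_equivariant[OF g(1) std_Flag std_Flag] g(2,3) by auto
next
  assume "minor_prod (gram V W) \<noteq> 0"
  then obtain u where u: "u \<in> lower_unipotent" "W = actX (matrix_inv (transpose (frame V)) ** u) std"
    using opposite_flags[OF V] W unfolding bij_betw_def by blast
  let ?M = "frame V"
  have M: "invertible ?M" and MT: "invertible (transpose ?M)"
    using frame(2)[OF V] invertible_transpose by auto
  have uT: "invertible (transpose u)" "upper (transpose u)"
    using u(1) lower_unipotent_invertible invertible_transpose lower_unipotent_transpose_upper by auto
  define g where "g = ?M ** matrix_inv (transpose u)"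
  have inv: "invertible g" unfolding g_def by (intro invertible_mult invertible_matrix_inv M uT)
  have "actX (matrix_inv (transpose u)) std = std"
    using actX_std_iff_upper invertible_matrix_inv[OF uT(1)] upper_matrix_inv[OF uT] by blast
  then have "actX g std = V" by (simp add: g_def actX_mult frame(3)[OF V])
  moreover have "transpose (matrix_inv g) = matrix_inv (transpose ?M) ** u"
  proof -
    have "matrix_inv (transpose ?M) ** u = transpose (transpose u ** matrix_inv ?M)"
    proof -
      have "transpose ?M ** transpose (matrix_inv ?M) = mat 1"
        by (simp add: matrix_inv_mult[OF M] transpose_mat flip: matrix_transpose_mul)
      from matrix_inv_unique[OF this] show ?thesis by (simp add: matrix_transpose_mul)
    qed
    moreover have "matrix_inv g = transpose u ** matrix_inv ?M"
    proof (rule matrix_inv_unique)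
      have "g ** (transpose u ** matrix_inv ?M) = ?M ** (matrix_inv (transpose u) ** transpose u) ** matrix_inv ?M"
        by (simp add: g_def matrix_mul_assoc)
      then show "g ** (transpose u ** matrix_inv ?M) = mat 1"
        by (simp add: matrix_inv_mult[OF M] matrix_inv_mult[OF uT(1)])
    qed
    ultimately show ?thesis by simp
  qed
  ultimately show "(V, W) \<in> std_orbit ds"
    using inv u(2) unfolding std_orbit_def GL_def actY_def by auto
qed

text \<open>
  The positions off the diagonal blocks split evenly into those below and those above them.
\<close>

lemma card_below_diagonal:
  "card {(a, b). lev b < lev a} = ((sum_list ds)\<^sup>2 - (\<Sum>k\<leftarrow>ds. k\<^sup>2)) div 2"
proof -
  let ?L = "{(a, b). lev b < lev a}" and ?U = "{(a, b). lev a < lev b}" and ?D = "{(a, b). lev a = lev b}"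
  have "card ?U = card ?L"
    by (rule bij_betw_same_card[of prod.swap]) (auto simp: bij_betw_def inj_on_def image_iff)
  moreover have "card (UNIV :: ('d \<times> 'd) set) = card ?L + card ?U + card ?D"
  proof -
    have "(UNIV :: ('d \<times> 'd) set) = (?L \<union> ?U) \<union> ?D" by auto
    moreover have "card ((?L \<union> ?U) \<union> ?D) = card (?L \<union> ?U) + card ?D" "card (?L \<union> ?U) = card ?L + card ?U"
      by (rule card_Un_disjoint; auto)+
    ultimately show ?thesis by simp
  qed
  moreover have "card ?D = (\<Sum>k\<leftarrow>ds. k\<^sup>2)"
  proof -
    have "?D = (\<Union>i<length ds. {j. lev j = i} \<times> {j. lev j = i})" using lev_less by auto
    also have "card \<dots> = (\<Sum>i<length ds. card ({j. lev j = i} \<times> {j. lev j = i}))"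
      by (rule card_UN_disjoint) auto
    also have "\<dots> = (\<Sum>i<length ds. (ds ! i)\<^sup>2)"
      by (simp add: card_cartesian_product card_lev_eq power2_eq_square)
    also have "\<dots> = (\<Sum>k\<leftarrow>ds. k\<^sup>2)" by (simp add: sum_list_sum_nth lessThan_atLeast0)
    finally show ?thesis .
  qed
  ultimately show ?thesis by (simp add: sum_ds power2_eq_square)
qed

lemma card_lower_unipotent:
  "card (lower_unipotent :: ('f::{field,finite} ^ 'd::_ ^ 'd::_) set) =
    CARD('f) ^ (((sum_list ds)\<^sup>2 - (\<Sum>k\<leftarrow>ds. k\<^sup>2)) div 2)"
proof -
  let ?F = "{f :: 'd \<times> 'd \<Rightarrow> 'f. \<forall>i. i \<notin> {(a, b). lev b < lev a} \<longrightarrow> f i = (if fst i = snd i then 1 else 0)}"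
  have "bij_betw (\<lambda>f. \<chi> a b. f (a, b)) ?F lower_unipotent"
    by (rule bij_betwI[where g = "\<lambda>u (a, b). u $ a $ b"])
       (auto simp: lower_unipotent_def not_less vec_eq_iff)
  then show ?thesis
    using card_functions_prescribed_outside[of "{(a, b). lev b < lev a}" "\<lambda>i. if fst i = snd i then 1 else 0 :: 'f"]
    by (simp add: bij_betw_same_card[symmetric] card_below_diagonal)
qed

end


section \<open>Monomial automorphisms and orthogonality\<close>

lemma mu_norm: "n > 0 \<Longrightarrow> z \<in> mu n \<Longrightarrow> cmod z = 1"
  using power_eq_1_iff[of z n] by (auto simp: mu_def)

lemma norm_1_mult_cnj: "cmod z = 1 \<Longrightarrow> z * cnj z = 1"
  by (simp flip: complex_norm_square)

definition monomial :: "('x \<Rightarrow> 'x) \<Rightarrow> ('x \<Rightarrow> complex) \<Rightarrow> 'x \<Rightarrow> 'x \<Rightarrow> complex" where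
  "monomial f a = (\<lambda>x' x. if x' = f x then a x else 0)"

lemma is_monomial_mat_monomial:
  assumes f: "bij_betw f X X" and a: "\<And>x. x \<in> X \<Longrightarrow> a x \<in> mu n" and n: "n > 0"
  shows "is_monomial_mat n X (monomial f a)"
proof -
  have nz: "a x \<noteq> 0" if "x \<in> X" for x
    using mu_norm[OF n a[OF that]] by auto
  show ?thesis
    unfolding is_monomial_mat_def
  proof (intro conjI ballI impI)
    fix x assume "x \<in> X"
    then obtain x' where x': "x' \<in> X" "f x' = x" using f by (metis bij_betw_imp_surj_on imageE)
    show "\<exists>!x'. x' \<in> X \<and> monomial f a x x' \<noteq> 0"
    proof (rule ex1I[of _ x'])
      show "x' \<in> X \<and> monomial f a x x' \<noteq> 0" using x' nz by (auto simp: monomial_def)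
    next
      fix y assume "y \<in> X \<and> monomial f a x y \<noteq> 0"
      then have "y \<in> X" "f y = f x'" using x' by (auto simp: monomial_def split: if_splits)
      then show "y = x'" using f x' by (auto simp: bij_betw_def inj_on_def)
    qed
  next
    fix x' assume "x' \<in> X"
    then show "\<exists>!x. x \<in> X \<and> monomial f a x x' \<noteq> 0"
      using nz bij_betwE[OF f] by (intro ex1I[of _ "f x'"]) (auto simp: monomial_def split: if_splits)
  next
    fix x x' assume "x \<in> X" "x' \<in> X" "monomial f a x x' \<noteq> 0"
    then show "monomial f a x x' \<in> mu n" using a by (auto simp: monomial_def split: if_splits)
  qed
qed

lemma mat_abs_monomial:
  assumes "\<And>x. x \<in> X \<Longrightarrow> cmod (a x) = 1"
  shows "mat_eq X X (mat_abs (monomial f a)) (perm_mat f)"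
  using assms by (auto simp: mat_eq_def mat_abs_def monomial_def perm_mat_def)

lemma perm_mat_eq_monomial: "perm_mat f = monomial f (\<lambda>_. 1)"
  by (simp add: perm_mat_def monomial_def)

lemma preserves_mat_monomial:
  assumes fin: "finite X" "finite Y" and f: "bij_betw f X X" and h: "bij_betw h Y Y"
    and eq: "\<And>x y. x \<in> X \<Longrightarrow> y \<in> Y \<Longrightarrow> a x * A x y * cnj (b y) = A (f x) (h y)"
  shows "preserves_mat X Y A (monomial f a) (monomial h b)"
  unfolding preserves_mat_def mat_eq_def
proof (intro ballI)
  fix x' y' assume "x' \<in> X" "y' \<in> Y"
  then obtain x y where x: "x \<in> X" "x' = f x" and y: "y \<in> Y" "y' = h y"
    using f h by (metis bij_betw_imp_surj_on imageE)
  have P: "monomial f a x' z = (if z = x then a x else 0)" if "z \<in> X" for z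
    using f x that by (auto simp: monomial_def bij_betw_def inj_on_def)
  have Q: "monomial h b y' z = (if z = y then b y else 0)" if "z \<in> Y" for z
    using h y that by (auto simp: monomial_def bij_betw_def inj_on_def)
  have "mat_mul X (monomial f a) A x' z = (\<Sum>x1\<in>X. if x1 = x then a x * A x z else 0)" for z
    unfolding mat_mul_def by (intro sum.cong) (auto simp: P)
  then have PA: "mat_mul X (monomial f a) A x' z = a x * A x z" for z
    using fin x by simp
  have "mat_mul Y (mat_mul X (monomial f a) A) (mat_adj (monomial h b)) x' y'
      = (\<Sum>z\<in>Y. if z = y then a x * A x y * cnj (b y) else 0)"
    unfolding mat_mul_def[of Y] mat_adj_def PA by (intro sum.cong) (auto simp: Q)
  also have "\<dots> = A x' y'" using fin x y eq by simp
  finally show "mat_mul Y (mat_mul X (monomial f a) A) (mat_adj (monomial h b)) x' y' = A x' y'" .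
qed

text \<open>
  Reindexing the inner product of the rows \<open>x\<close> and \<open>x'\<close> by \<open>h\<close> multiplies it by a constant other than 1.
\<close>

lemma rows_orthogonal:
  fixes A :: "'x \<Rightarrow> 'y \<Rightarrow> complex"
  assumes h: "bij_betw h Y Y"
    and x: "\<And>y. y \<in> Y \<Longrightarrow> A x (h y) = s * b y * A x y"
    and x': "\<And>y. y \<in> Y \<Longrightarrow> A x' (h y) = s' * b y * A x' y"
    and b: "\<And>y. y \<in> Y \<Longrightarrow> cmod (b y) = 1" and s: "s * cnj s' \<noteq> 1"
  shows "(\<Sum>y\<in>Y. A x y * cnj (A x' y)) = 0"
proof -
  let ?S = "\<Sum>y\<in>Y. A x y * cnj (A x' y)"
  have "?S = (\<Sum>y\<in>Y. A x (h y) * cnj (A x' (h y)))"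
    by (rule sum.reindex_bij_betw[OF h, symmetric])
  also have "\<dots> = (\<Sum>y\<in>Y. s * cnj s' * (A x y * cnj (A x' y)))"
  proof (rule sum.cong)
    fix y assume y: "y \<in> Y"
    have "A x (h y) * cnj (A x' (h y)) = s * cnj s' * (b y * cnj (b y)) * (A x y * cnj (A x' y))"
      unfolding x[OF y] x'[OF y] by (simp add: mult_ac)
    then show "A x (h y) * cnj (A x' (h y)) = s * cnj s' * (A x y * cnj (A x' y))"
      using norm_1_mult_cnj[OF b[OF y]] by simp
  qed simp
  also have "\<dots> = s * cnj s' * ?S" by (simp add: sum_distrib_left)
  finally have "(s * cnj s' - 1) * ?S = 0" by (simp add: algebra_simps)
  then show ?thesis using s by simp
qed

section \<open>Dilations that separate two flags\<close>

context flag_type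
begin

lemma bij_actX:
  fixes g :: "'f::{field,finite} ^ 'd::_ ^ 'd::_"
  assumes "invertible g"
  shows "bij_betw (actX g) (Flag ds) (Flag ds)"
proof -
  have "inj_on (actX g) (Flag ds)" using actX_inj[OF assms] by (auto intro: inj_onI)
  moreover have "actX g ` Flag ds \<subseteq> Flag ds" using actX_Flag[OF ds_nonempty assms] by blast
  ultimately show ?thesis using endo_inj_surj[OF finite_Flag] by (simp add: bij_betw_def)
qed

text \<open>
  In the coordinates of a frame, \<open>v\<close> has a nonzero coordinate that vanishes on \<open>V ! i\<close>; the functional
  is a multiple of this coordinate.
\<close>

lemma ex_functional:
  fixes v :: "'f::{field,finite} ^ 'd::_"
  assumes V: "V \<in> Flag ds" and i: "i < length ds" and v: "v \<notin> V ! i"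
  shows "\<exists>b. (\<Sum>k\<in>UNIV. b $ k * v $ k) = 1 \<and> (\<forall>u\<in>V ! i. (\<Sum>k\<in>UNIV. b $ k * u $ k) = 0)"
proof -
  let ?M = "frame V"
  have M: "invertible ?M" by (rule frame(2)[OF V])
  have Vi: "V ! i = (*v) ?M ` E i"
    using frame(3)[OF V] i by (metis nth_actX nth_std length_std)
  let ?a = "matrix_inv ?M *v v"
  have Ma: "?M *v ?a = v" using matrix_inv_mult(1)[OF M] by (simp add: matrix_vector_mul_assoc)
  then have "?a \<notin> E i" using v Vi by (metis imageI)
  then obtain k where k: "i < lev k" "?a $ k \<noteq> 0" by (auto simp: E_def)
  define b where "b = transpose (matrix_inv ?M) *v axis k (1 / ?a $ k)"
  have b: "(\<Sum>l\<in>UNIV. b $ l * u $ l) = (matrix_inv ?M *v u) $ k / ?a $ k" for u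
    unfolding b_def sum_matrix_vector_transpose
    by (simp add: axis_def if_distrib[of "\<lambda>x. x * _"] cong: if_cong)
  have "(matrix_inv ?M *v u) $ k = 0" if u: "u \<in> V ! i" for u
  proof -
    obtain w where w: "w \<in> E i" "u = ?M *v w" using u unfolding Vi by blast
    then have "matrix_inv ?M *v u = w"
      using matrix_inv_mult(2)[OF M] by (simp add: matrix_vector_mul_assoc)
    then show ?thesis using w(1) k(1) by (simp add: E_def)
  qed
  then show ?thesis using b k(2) by (intro exI[of _ b]) auto
qed

text \<open>
  Let \<open>i\<close> be the first place where the flags differ. Take \<open>v\<close> in \<open>V ! i\<close> but not in \<open>V' ! i\<close>, and let \<open>j\<close> be
  the first place where \<open>v\<close> occurs in \<open>V'\<close>, so that \<open>i < j\<close>. The hyperplane is chosen to contain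
  \<open>V' ! (j - 1)\<close>, hence all members of \<open>V'\<close> below \<open>j\<close>, and also all members of \<open>V\<close> below \<open>i\<close>, as these
  are shared by both flags. So \<open>v\<close> lies in exactly the members of \<open>V\<close> from \<open>i\<close> on and in exactly those of
  \<open>V'\<close> from \<open>j\<close> on.
\<close>

lemma separating_dilation:
  fixes V V' :: "('f::{field,finite} ^ 'd::_) set list"
  assumes V: "V \<in> Flag ds" and V': "V' \<in> Flag ds" and ne: "V \<noteq> V'"
  obtains v b where "(\<Sum>k\<in>UNIV. b $ k * v $ k) = 1"
    "\<And>i. i < length ds \<Longrightarrow> v \<in> V ! i \<or> (\<forall>u\<in>V ! i. (\<Sum>k\<in>UNIV. b $ k * u $ k) = 0)"
    "\<And>i. i < length ds \<Longrightarrow> v \<in> V' ! i \<or> (\<forall>u\<in>V' ! i. (\<Sum>k\<in>UNIV. b $ k * u $ k) = 0)"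
    "0 < card {i. i < length ds \<and> v \<in> V' ! i}"
    "card {i. i < length ds \<and> v \<in> V' ! i} < card {i. i < length ds \<and> v \<in> V ! i}"
proof -
  let ?r = "length ds"
  have len: "length V = ?r" "length V' = ?r" using V V' by (auto simp: Flag_def)
  then have ex: "\<exists>i<?r. V ! i \<noteq> V' ! i" using ne by (auto simp: list_eq_iff_nth_eq)
  define i where "i = (LEAST i. i < ?r \<and> V ! i \<noteq> V' ! i)"
  have i: "i < ?r" "V ! i \<noteq> V' ! i" using LeastI_ex[OF ex] by (auto simp: i_def)
  have before: "V ! k = V' ! k" if "k < i" for k
    using not_less_Least[of k] that i(1) unfolding i_def by fastforce
  have "\<not> V ! i \<subseteq> V' ! i"
    using i V V' vec.subspace_dim_equal[of "V ! i" "V' ! i"] by (auto simp: Flag_def)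
  then obtain v where v: "v \<in> V ! i" "v \<notin> V' ! i" by blast
  have top: "V' ! (?r - 1) = UNIV"
    using V' len ds_nonempty by (metis (mono_tags, lifting) Flag_def last_conv_nth length_0_conv mem_Collect_eq)
  have r: "?r - 1 < ?r" using ds_nonempty by simp
  have ex': "\<exists>j. j < ?r \<and> v \<in> V' ! j" using top r by blast
  define j where "j = (LEAST j. j < ?r \<and> v \<in> V' ! j)"
  have j: "j < ?r" "v \<in> V' ! j" using LeastI_ex[OF ex'] by (auto simp: j_def)
  have jmin: "v \<notin> V' ! k" if "k < j" for k
    using not_less_Least[of k] that j(1) unfolding j_def by fastforce
  have ij: "i < j"
  proof (rule ccontr)
    assume "\<not> i < j"
    then have "V' ! j \<subseteq> V' ! i" using Flag_member_mono[OF V' _ i(1)] by simp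
    then show False using j v by blast
  qed
  have "j - 1 < ?r" "v \<notin> V' ! (j - 1)" using j(1) jmin[of "j - 1"] ij by auto
  from ex_functional[OF V' this]
  obtain b where b: "(\<Sum>k\<in>UNIV. b $ k * v $ k) = 1" "\<And>u. u \<in> V' ! (j - 1) \<Longrightarrow> (\<Sum>k\<in>UNIV. b $ k * u $ k) = 0"
    by blast
  have V'_low: "V' ! k \<subseteq> V' ! (j - 1)" if "k < j" for k
    using Flag_member_mono[OF V', of k "j - 1"] that j(1) by simp
  have V_high: "v \<in> V ! k" if "i \<le> k" "k < ?r" for k
    using Flag_member_mono[OF V that] v(1) by blast
  have V'_high: "j \<le> k" if "v \<in> V' ! k" for k
    using jmin that not_less by blast
  show thesis
  proof (rule that[of b v])
    show "(\<Sum>k\<in>UNIV. b $ k * v $ k) = 1" by (rule b)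
  next
    fix k assume k: "k < ?r"
    show "v \<in> V ! k \<or> (\<forall>u\<in>V ! k. (\<Sum>k\<in>UNIV. b $ k * u $ k) = 0)"
    proof (cases "i \<le> k")
      case False
      then have "V ! k \<subseteq> V' ! (j - 1)" using before[of k] V'_low[of k] ij by simp
      then show ?thesis using b(2) by blast
    qed (use V_high k in blast)
    show "v \<in> V' ! k \<or> (\<forall>u\<in>V' ! k. (\<Sum>k\<in>UNIV. b $ k * u $ k) = 0)"
    proof (cases "k < j")
      case True
      then show ?thesis using b(2) V'_low by blast
    next
      case False
      then have "V' ! j \<subseteq> V' ! k" using Flag_member_mono[OF V' _ k] by simp
      then show ?thesis using j(2) by blast
    qed
  next
    show "0 < card {k. k < ?r \<and> v \<in> V' ! k}" using j by (auto simp: card_gt_0_iff)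
    have "{k. k < ?r \<and> v \<in> V' ! k} \<subseteq> {k. k < ?r \<and> v \<in> V ! k}"
      using V_high V'_high ij by force
    moreover have "i \<in> {k. k < ?r \<and> v \<in> V ! k}" "i \<notin> {k. k < ?r \<and> v \<in> V' ! k}"
      using i(1) v by auto
    ultimately show "card {k. k < ?r \<and> v \<in> V' ! k} < card {k. k < ?r \<and> v \<in> V ! k}"
      by (intro psubset_card_mono) auto
  qed
qed

lemma minor_prod_cocycle_dilation:
  fixes V :: "('f::{field,finite} ^ 'd::_) set list"
  assumes V: "V \<in> Flag ds" and t: "t \<noteq> 0" and bv: "(\<Sum>k\<in>UNIV. b $ k * v $ k) = 1"
    and Vi: "\<And>i. i < length ds \<Longrightarrow> v \<in> V ! i \<or> (\<forall>u \<in> V ! i. (\<Sum>k\<in>UNIV. b $ k * u $ k) = 0)"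
  shows "actX (dilation t v b) V = V"
    and "minor_prod (cocycle (dilation t v b) V) = t ^ card {i. i < length ds \<and> v \<in> V ! i}"
proof -
  let ?g = "dilation t v b" and ?M = "frame V"
  let ?p = "dilation t (matrix_inv ?M *v v) (transpose ?M *v b)"
  note p = dilation_in_frame[OF frame(1)[OF V] t bv Vi]
  have "actX ?g V = actX (?g ** ?M) std" by (simp add: actX_mult frame(3)[OF V])
  also have "\<dots> = actX ?M (actX ?p std)" by (simp add: actX_mult flip: p(3))
  also have "actX ?p std = std" using actX_std_iff_upper[OF p(1)] p(2) by simp
  finally show gV: "actX ?g V = V" by (simp add: frame(3)[OF V])
  have "cocycle ?g V = matrix_inv ?M ** (?g ** ?M)" by (simp add: cocycle_def gV matrix_mul_assoc)
  also have "\<dots> = ?p" by (simp add: matrix_mul_assoc matrix_inv_mult(2)[OF frame(2)[OF V]] flip: p(3))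
  finally show "minor_prod (cocycle ?g V) = t ^ card {i. i < length ds \<and> v \<in> V ! i}"
    using p(4) by simp
qed

end

section \<open>The weighing matrix\<close>

locale flag_character = flag_type ds dim_type
  for ds :: "nat list" and dim_type :: "'d::{finite,linorder} itself" +
  fixes n :: nat and \<psi> :: "'f::{field,finite} \<Rightarrow> complex" and t :: 'f
  assumes n: "length ds \<le> n"
    and psi_mult: "\<psi> (x * y) = \<psi> x * \<psi> y" and psi_0: "\<psi> 0 = 0"
    and psi_root: "x \<noteq> 0 \<Longrightarrow> \<psi> x ^ n = 1"
    and psi_1: "\<psi> 1 = 1"
    and t: "t \<noteq> 0" and t_prim: "0 < k \<Longrightarrow> k < n \<Longrightarrow> \<psi> t ^ k \<noteq> 1"
begin

definition weighing :: "('f ^ 'd::_) set list \<Rightarrow> ('f ^ 'd::_) set list \<Rightarrow> complex" where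
  "weighing V W = \<psi> (minor_prod (gram V W))"

text \<open>
  The values of \<open>\<psi>\<close> have modulus 1, so the conjugate is the inverse.
\<close>

definition phase :: "'f ^ 'd::_ ^ 'd::_ \<Rightarrow> ('f ^ 'd::_) set list \<Rightarrow> complex" where
  "phase g V = cnj (\<psi> (minor_prod (cocycle g V)))"

lemma n_pos: "n > 0"
  using n ds_nonempty by (cases n) auto

lemma psi_norm: "x \<noteq> 0 \<Longrightarrow> cmod (\<psi> x) = 1"
  using psi_root[of x] n_pos by (intro mu_norm[of n]) (auto simp: mu_def)

lemma psi_power: "\<psi> (x ^ k) = \<psi> x ^ k"
  by (induction k) (auto simp: psi_1 psi_mult)

lemma phase_mu:
  assumes "invertible g" "V \<in> Flag ds"
  shows "phase g V \<in> mu n"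
  using psi_root minor_prod_upper_nonzero[OF cocycle(1,2)[OF assms]]
  by (simp add: phase_def mu_def flip: complex_cnj_power)

lemma weighing_equivariant:
  assumes g: "invertible g" and VW: "V \<in> Flag ds" "W \<in> Flag ds"
  defines "h \<equiv> transpose (matrix_inv g)"
  shows "weighing (actX g V) (actX h W) = phase g V * phase h W * weighing V W"
proof -
  have h: "invertible h" unfolding h_def by (intro invertible_transpose invertible_matrix_inv g)
  have 1: "phase g V * \<psi> (minor_prod (cocycle g V)) = 1" "phase h W * \<psi> (minor_prod (cocycle h W)) = 1"
    unfolding phase_def
    using norm_1_mult_cnj[OF psi_norm] minor_prod_upper_nonzero[OF cocycle(1,2)] g h VW
    by (metis mult.commute)+
  have "weighing V W = \<psi> (minor_prod (cocycle g V)) * weighing (actX g V) (actX h W) * \<psi> (minor_prod (cocycle h W))"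
    unfolding weighing_def h_def by (simp flip: psi_mult gram_equivariant[OF g VW])
  then have "phase g V * phase h W * weighing V W =
      (phase g V * \<psi> (minor_prod (cocycle g V))) * (phase h W * \<psi> (minor_prod (cocycle h W))) *
      weighing (actX g V) (actX h W)"
    by (simp add: mult_ac)
  then show ?thesis using 1 by simp
qed

lemma weighing_norm: "cmod (weighing V W) = (if minor_prod (gram V W) = 0 then 0 else 1)"
  by (simp add: weighing_def psi_0 psi_norm)

text \<open>
  A separating dilation fixes both flags, with phases that are the conjugates of distinct powers of
  \<open>\<psi> t\<close>. The exponents lie between 1 and \<open>length ds\<close>, so they differ by less than \<open>n\<close>.
\<close>

lemma weighing_orthogonal:
  assumes V: "V \<in> Flag ds" and V': "V' \<in> Flag ds" and ne: "V \<noteq> V'"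
  shows "(\<Sum>W\<in>Flag ds. weighing V W * cnj (weighing V' W)) = 0"
proof -
  obtain v b where bv: "(\<Sum>k\<in>UNIV. b $ k * v $ k) = 1"
    and Vi: "\<And>i. i < length ds \<Longrightarrow> v \<in> V ! i \<or> (\<forall>u\<in>V ! i. (\<Sum>k\<in>UNIV. b $ k * u $ k) = 0)"
    and V'i: "\<And>i. i < length ds \<Longrightarrow> v \<in> V' ! i \<or> (\<forall>u\<in>V' ! i. (\<Sum>k\<in>UNIV. b $ k * u $ k) = 0)"
    and less: "0 < card {i. i < length ds \<and> v \<in> V' ! i}"
      "card {i. i < length ds \<and> v \<in> V' ! i} < card {i. i < length ds \<and> v \<in> V ! i}"
    by (rule separating_dilation[OF V V' ne]) (rule that)
  define m where "m = card {i. i < length ds \<and> v \<in> V ! i}"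
  define m' where "m' = card {i. i < length ds \<and> v \<in> V' ! i}"
  let ?g = "dilation t v b"
  let ?h = "transpose (matrix_inv ?g)"
  have "det ?g = t" by (simp add: det_dilation bv)
  then have g: "invertible ?g" using t by (simp add: invertible_det_nz)
  have h: "invertible ?h" by (intro invertible_transpose invertible_matrix_inv g)
  note fixV = minor_prod_cocycle_dilation[OF V t bv Vi]
    and fixV' = minor_prod_cocycle_dilation[OF V' t bv V'i]
  have "m \<le> length ds"
    unfolding m_def using card_mono[of "{..<length ds}" "{i. i < length ds \<and> v \<in> V ! i}"] by auto
  then have mm: "0 < m - m'" "m - m' < n" "m' < m" using less n unfolding m_def m'_def by linarith+
  have ph: "phase ?g V * cnj (phase ?g V') \<noteq> 1"
  proof
    assume *: "phase ?g V * cnj (phase ?g V') = 1"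
    have "\<psi> t ^ m' * cnj (\<psi> t ^ m) = 1"
      using * by (simp add: phase_def fixV fixV' psi_power m_def m'_def mult.commute)
    moreover have "\<psi> t ^ m = \<psi> t ^ m' * \<psi> t ^ (m - m')" using mm by (simp flip: power_add)
    moreover have "cmod (\<psi> t ^ m') = 1" using psi_norm[OF t] by (simp add: norm_power)
    ultimately have "cnj (\<psi> t ^ (m - m')) = 1"
      using norm_1_mult_cnj[of "\<psi> t ^ m'"] by (simp add: mult.assoc[symmetric])
    then have "\<psi> t ^ (m - m') = 1" by (metis complex_cnj_cnj complex_cnj_one)
    then show False using t_prim mm by blast
  qed
  show ?thesis
  proof (rule rows_orthogonal[OF bij_actX[OF h]])
    fix W :: "('f ^ 'd::_) set list" assume W: "W \<in> Flag ds"
    show "weighing V (actX ?h W) = phase ?g V * phase ?h W * weighing V W"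
      using weighing_equivariant[OF g V W] by (simp add: fixV)
    show "weighing V' (actX ?h W) = phase ?g V' * phase ?h W * weighing V' W"
      using weighing_equivariant[OF g V' W] by (simp add: fixV')
    show "cmod (phase ?h W) = 1" by (rule mu_norm[OF n_pos phase_mu[OF h W]])
  qed (rule ph)
qed

text \<open>
  The diagonal entries count the flags opposite to a given one, that is, the block lower unipotent
  matrices.
\<close>

lemma weighing_GW:
  "weighing \<in> GW (Flag ds) (Flag ds) (card (Flag ds :: ('f ^ 'd::_) set list set))
    (CARD('f) ^ (((sum_list ds)\<^sup>2 - (\<Sum>k\<leftarrow>ds. k\<^sup>2)) div 2)) n"
proof -
  have "weighing V W \<in> mu_plus n" for V W
    unfolding weighing_def mu_plus_def mu_def using psi_root psi_0 by (cases "minor_prod (gram V W) = 0") auto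
  moreover have "(\<Sum>W\<in>Flag ds. weighing V W * cnj (weighing V W)) =
      of_nat (CARD('f) ^ (((sum_list ds)\<^sup>2 - (\<Sum>k\<leftarrow>ds. k\<^sup>2)) div 2))" if V: "V \<in> Flag ds" for V
  proof -
    have "weighing V W * cnj (weighing V W) = (if minor_prod (gram V W) \<noteq> 0 then 1 else 0)" for W
      using norm_1_mult_cnj[of "weighing V W"] by (auto simp: weighing_norm) (simp add: weighing_def psi_0)
    then have "(\<Sum>W\<in>Flag ds. weighing V W * cnj (weighing V W)) = of_nat (card {W \<in> Flag ds. minor_prod (gram V W) \<noteq> 0})"
      by (simp add: sum.If_cases[OF finite_Flag] Int_def)
    also have "card {W \<in> Flag ds. minor_prod (gram V W) \<noteq> 0} = card (lower_unipotent :: ('f ^ 'd::_ ^ 'd::_) set)"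
      by (rule bij_betw_same_card[OF opposite_flags[OF V], symmetric])
    finally show ?thesis by (simp only: card_lower_unipotent)
  qed
  ultimately show ?thesis
    using weighing_orthogonal
    by (auto simp: GW_def finite_Flag mat_eq_def mat_mul_def mat_adj_def scalar_mat_def)
qed

lemma weighing_abs: "mat_eq (Flag ds) (Flag ds) (mat_abs weighing) (char_mat (std_orbit ds))"
  by (simp add: mat_eq_def mat_abs_def char_mat_def std_orbit_iff weighing_norm)

text \<open>
  The phases of \<open>g\<close> and of its contragredient are the nonzero entries of the lift. The matrix on the columns
  enters through its adjoint, which is why its entries are conjugated.
\<close>

lemma weighing_lift:
  assumes "\<beta> \<in> gl_perm ` GL"
  shows "\<beta> \<in> PermAut (Flag ds) (Flag ds) (mat_abs weighing) \<and>
    (\<exists>\<alpha>\<in>Aut n (Flag ds) (Flag ds) weighing. lifts (Flag ds) (Flag ds) \<alpha> \<beta>)"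
proof
  obtain g :: "'f ^ 'd::_ ^ 'd::_" where g: "invertible g"
    and \<beta>: "\<beta> = (perm_mat (actX g), perm_mat (actX (transpose (matrix_inv g))))"
    using assms by (auto simp: gl_perm_def GL_def actY_def fun_eq_iff)
  let ?h = "transpose (matrix_inv g)"
  have h: "invertible ?h" by (intro invertible_transpose invertible_matrix_inv g)
  note bg = bij_actX[OF g] and bh = bij_actX[OF h]
  have nrm: "cmod (phase k V) = 1" if "invertible k" "V \<in> Flag ds" for k V
    by (rule mu_norm[OF n_pos phase_mu[OF that]])
  have "preserves_mat (Flag ds) (Flag ds) (mat_abs weighing) (monomial (actX g) (\<lambda>_. 1)) (monomial (actX ?h) (\<lambda>_. 1))"
    by (rule preserves_mat_monomial[OF finite_Flag finite_Flag bg bh])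
       (simp add: mat_abs_def weighing_equivariant[OF g] norm_mult nrm g h)
  then show "\<beta> \<in> PermAut (Flag ds) (Flag ds) (mat_abs weighing)"
    unfolding PermAut_def \<beta> is_perm_mat_def perm_mat_eq_monomial mat_eq_def using bg bh by auto
  let ?a = "(monomial (actX g) (phase g), monomial (actX ?h) (\<lambda>W. cnj (phase ?h W)))"
  have "preserves_mat (Flag ds) (Flag ds) weighing (fst ?a) (snd ?a)"
    unfolding fst_conv snd_conv
    by (rule preserves_mat_monomial[OF finite_Flag finite_Flag bg bh])
       (simp add: weighing_equivariant[OF g] mult_ac)
  moreover have "is_monomial_mat n (Flag ds) (fst ?a)" "is_monomial_mat n (Flag ds) (snd ?a)"
    unfolding fst_conv snd_conv using phase_mu g h n_pos bg bh
    by (auto intro!: is_monomial_mat_monomial simp: mu_def simp flip: complex_cnj_power)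
  ultimately have "?a \<in> Aut n (Flag ds) (Flag ds) weighing" by (simp add: Aut_def)
  moreover have "lifts (Flag ds) (Flag ds) ?a \<beta>"
    unfolding lifts_def \<beta> fst_conv snd_conv
    using nrm g h by (intro conjI mat_abs_monomial) auto
  ultimately show "\<exists>\<alpha>\<in>Aut n (Flag ds) (Flag ds) weighing. lifts (Flag ds) (Flag ds) \<alpha> \<beta>" by blast
qed

end

theorem theorem6p13:
  fixes q n d :: nat and ds :: "nat list"
    and X Y :: "(('f :: {field, finite}) ^ ('d :: {finite, linorder})) set list set"
  assumes "primepow q" and "CARD('f) = q"
    and "\<forall>k\<in>set ds. k > 0" and "d = sum_list ds" and "CARD('d) = d"
    and "n > 1" and "n dvd (q - 1)"
    and "length ds \<le> n"
    and "X = Flag ds" and "Y = Flag ds"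
  shows "\<exists>N A. real N = gauss_multinomial (real q) d ds \<and>
           A \<in> GW X Y N (q ^ ((d ^ 2 - (\<Sum>k\<leftarrow>ds. k ^ 2)) div 2)) n \<and>
           mat_eq X Y (mat_abs A) (char_mat (std_orbit ds)) \<and>
           (\<forall>\<beta> \<in> gl_perm ` GL. \<beta> \<in> PermAut X Y (mat_abs A) \<and>
              (\<exists>\<alpha> \<in> Aut n X Y A. lifts X Y \<alpha> \<beta>))"
proof -
  have "n > 0" "n dvd CARD('f) - 1" using assms by auto
  then obtain \<psi> :: "'f \<Rightarrow> complex" and t where
    "\<And>x y. \<psi> (x * y) = \<psi> x * \<psi> y" "\<psi> 0 = 0" "\<psi> 1 = 1" "\<And>x. x \<noteq> 0 \<Longrightarrow> \<psi> x ^ n = 1"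
    "t \<noteq> 0" "\<And>k. 0 < k \<Longrightarrow> k < n \<Longrightarrow> \<psi> t ^ k \<noteq> 1"
    using finite_field_character by metis
  then interpret flag_character ds "TYPE('d)" n \<psi> t
    using assms by unfold_locales auto
  have "real (card (Flag ds :: ('f ^ 'd::{finite,linorder}) set list set)) = gauss_multinomial (real q) d ds"
    using card_Flag[of ds, where ?'d = 'd and ?'f = 'f] assms by simp
  then show ?thesis
    using weighing_GW weighing_abs weighing_lift assms by blast
qed

end
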